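(* Let $(W,S)$ be a Coxeter system with $S$ finite, and let $B$ be a finite Garside shadow in $(W,S)$. Let $\mathcal{V}_B$ be the voracious language of $B$. Then $(S,\mathcal{V}_B)$ is a biautomatic structure for $W$.
   Context: **Coxeter systems.** $(W,S)$ is a Coxeter system with $S$ finite: $W$ is generated by $S$ subject only to the relations $s^2=\mathrm{id}$ for $s\in S$ and $(st)^{m_{st}}=\mathrm{id}$ for $s\ne t\in S$, where $m_{st}=m_{ts}\in\{2,3,\ldots,\infty\}$ ($m_{st}=\infty$ means no relation is imposed). $\ell(g)$ is the word length of $g\in W$ with respect to $S$, and $d(g,h)=\ell(g^{-1}h)$. An element $w$ is a suffix of $g$ if $g=uw$ for some $u\in W$ with $\ell(g)=\ell(u)+\ell(w)$. The right weak order $\preceq$ on $W$ is: $g\preceq h$ iff $g$ lies on a geodesic from $\mathrm{id}$ to $h$ in the Cayley graph of $W$ (edges joining $g$ to $gs$, $s\in S$), i.e. $\ell(h)=\ell(g)+\ell(g^{-1}h)$. It is a complete meet-semilattice, so every subset bounded above has a least upper bound (join) $\bigvee$. **Words.** $S^*$ is the set of words over $S$, including the empty word $\varepsilon$. For $v\in S^*$, $\overline v\in W$ is the element it represents. If $v$ has length $n$, then $v(i)$ is the prefix of $v$ of length $i$ for $1\le i\le n-1$, and $v(i)=v$ for $i\ge n$. **Garside shadows.** A Garside shadow in $(W,S)$ is a subset $B\subseteq W$ containing $S$ such that (1) for any $X\subseteq B$, if $\bigvee X$ exists then $\bigvee X\in B$; (2) if $b\in B$ and $w$ is a suffix of $b$,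 then $w\in B$. The $B$-projection $\pi_B:W\to B$ is $\pi_B(g)=\bigvee\{b\in B: b\preceq g\}$ (this join always exists). **Voracious projection and language.** The voracious projection with respect to $B$ is $\nu_B:W\to W$, $\nu_B(g)=g\,\pi_B(g^{-1})$; one has $\ell(\nu_B(g))<\ell(g)$ for $g\neq \mathrm{id}$. Define languages $\mathcal{L}_g$ inductively on $\ell(g)$ by $\mathcal{L}_{\mathrm{id}}=\{\varepsilon\}$ and, for $g\ne\mathrm{id}$, $\mathcal{L}_g=\{uv: u\in\mathcal{L}_{\nu_B(g)},\ v\in S^*\text{ of minimal length such that }\overline v=\nu_B(g)^{-1}g\}$. The voracious language is $\mathcal{V}_B=\bigcup_{g\in W}\mathcal{L}_g$. **Biautomatic structures.** A biautomatic structure for a group $G$ is a pair $(S,\mathcal{L})$ where $S$ is a finite generating set of $G$ closed under inversion and $\mathcal{L}\subseteq S^*$ is a regular language (the language accepted by some finite state automaton over $S$) for which there exist constants $C$ and $C'$ such that: (1) for every $g\in G$ there is a word in $\mathcal{L}$ representing $g$; (2) for every $v,v'\in\mathcal{L}$ representing $g,g'\in G$ with $g'=gs$ for some $s\in S$, $d(\overline{v(i)},\overline{v'(i)})\le C$ for all $i\ge1$; (3) for every $v,v'\in\mathcal{L}$ representing $g,g'\in G$ with $g'=sg$ for some $s\in S$, $d(s\overline{v(i)},\overline{v'(i)})\le C'$ for all $i\ge1$. Here $d$ is the word metric with respect to $S$. *)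

theory Defs
  imports "HOL-Algebra.Lattice" "HOL-Algebra.Generated_Groups" "HOL-Library.Extended_Nat"
begin

section \<open>Words and the word metric\<close>

definition word_eval :: "('a, 'b) monoid_scheme \<Rightarrow> 'a list \<Rightarrow> 'a" where
  "word_eval G w = foldr (\<otimes>\<^bsub>G\<^esub>) w \<one>\<^bsub>G\<^esub>"

text \<open>Words use letters of \<open>S\<close> only, not their inverses. This is the usual word length
  when \<open>S\<close> is a generating set closed under inversion, the only case of interest below.\<close>

definition word_length :: "('a, 'b) monoid_scheme \<Rightarrow> 'a set \<Rightarrow> 'a \<Rightarrow> nat" where
  "word_length G S g = (LEAST n. \<exists>w \<in> lists S. length w = n \<and> word_eval G w = g)"

definition word_dist :: "('a, 'b) monoid_scheme \<Rightarrow> 'a set \<Rightarrow> 'a \<Rightarrow> 'a \<Rightarrow> nat" where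
  "word_dist G S g h = word_length G S (inv\<^bsub>G\<^esub> g \<otimes>\<^bsub>G\<^esub> h)"


section \<open>Coxeter systems\<close>

text \<open>The values of \<open>m\<close> off the pairs of distinct elements of \<open>S\<close> play no role.\<close>

definition coxeter_relators :: "'a set \<Rightarrow> ('a \<Rightarrow> 'a \<Rightarrow> enat) \<Rightarrow> 'a list set" where
  "coxeter_relators S m =
     {[s, s] | s. s \<in> S} \<union>
     {concat (replicate n [s, t]) | s t n. s \<in> S \<and> t \<in> S \<and> s \<noteq> t \<and> m s t = enat n}"

text \<open>The congruence on the free monoid \<open>lists S\<close> generated by \<open>r \<sim> []\<close> for the relators \<open>r\<close>.
  As every \<open>[s, s]\<close> is a relator, each letter is its own inverse modulo this congruence, so no
  formal inverses are needed and the quotient is the group presented by these relators.\<close>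

definition coxeter_congruent :: "'a set \<Rightarrow> ('a \<Rightarrow> 'a \<Rightarrow> enat) \<Rightarrow> 'a list \<Rightarrow> 'a list \<Rightarrow> bool" where
  "coxeter_congruent S m =
     equivclp (\<lambda>x y. \<exists>u \<in> lists S. \<exists>v \<in> lists S. \<exists>r \<in> coxeter_relators S m.
                       x = u @ r @ v \<and> y = u @ v)"

definition coxeter_system :: "('a, 'b) monoid_scheme \<Rightarrow> 'a set \<Rightarrow> bool" where
  "coxeter_system W S \<longleftrightarrow>
     group W \<and> S \<subseteq> carrier W \<and> generate W S = carrier W \<and>
     (\<exists>m :: 'a \<Rightarrow> 'a \<Rightarrow> enat.
        (\<forall>s \<in> S. \<forall>t \<in> S. s \<noteq> t \<longrightarrow> 2 \<le> m s t \<and> m s t = m t s) \<and>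
        (\<forall>u \<in> lists S. \<forall>v \<in> lists S.
           word_eval W u = word_eval W v \<longleftrightarrow> coxeter_congruent S m u v))"

definition is_suffix :: "('a, 'b) monoid_scheme \<Rightarrow> 'a set \<Rightarrow> 'a \<Rightarrow> 'a \<Rightarrow> bool" where
  "is_suffix W S w g \<longleftrightarrow>
     w \<in> carrier W \<and>
     (\<exists>u \<in> carrier W. g = u \<otimes>\<^bsub>W\<^esub> w \<and>
        word_length W S g = word_length W S u + word_length W S w)"

definition right_weak_order :: "('a, 'b) monoid_scheme \<Rightarrow> 'a set \<Rightarrow> 'a gorder" where
  "right_weak_order W S =
     \<lparr>carrier = carrier W, eq = (=),
      le = (\<lambda>g h. word_length W S h = word_length W S g + word_length W S (inv\<^bsub>W\<^esub> g \<otimes>\<^bsub>W\<^esub> h))\<rparr>"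


section \<open>Garside shadows and the voracious language\<close>

definition garside_shadow :: "('a, 'b) monoid_scheme \<Rightarrow> 'a set \<Rightarrow> 'a set \<Rightarrow> bool" where
  "garside_shadow W S B \<longleftrightarrow>
     S \<subseteq> B \<and> B \<subseteq> carrier W \<and>
     (\<forall>X j. X \<subseteq> B \<longrightarrow>
        least (right_weak_order W S) j (Upper (right_weak_order W S) X) \<longrightarrow> j \<in> B) \<and>
     (\<forall>b \<in> B. \<forall>w. is_suffix W S w b \<longrightarrow> w \<in> B)"

definition garside_proj :: "('a, 'b) monoid_scheme \<Rightarrow> 'a set \<Rightarrow> 'a set \<Rightarrow> 'a \<Rightarrow> 'a" where
  "garside_proj W S B g =
     \<Squnion>\<^bsub>right_weak_order W S\<^esub> {b \<in> B. b \<sqsubseteq>\<^bsub>right_weak_order W S\<^esub> g}"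

definition voracious_proj :: "('a, 'b) monoid_scheme \<Rightarrow> 'a set \<Rightarrow> 'a set \<Rightarrow> 'a \<Rightarrow> 'a" where
  "voracious_proj W S B g = g \<otimes>\<^bsub>W\<^esub> garside_proj W S B (inv\<^bsub>W\<^esub> g)"

text \<open>\<open>voracious_word W S B g w\<close> means \<open>w \<in> L\<^sub>g\<close>. Since the voracious projection strictly
  decreases length off the identity, the least fixed point taken here is the recursion on the
  length of \<open>g\<close>.\<close>

inductive voracious_word ::
    "('a, 'b) monoid_scheme \<Rightarrow> 'a set \<Rightarrow> 'a set \<Rightarrow> 'a \<Rightarrow> 'a list \<Rightarrow> bool"
  for W S B where
  one: "voracious_word W S B \<one>\<^bsub>W\<^esub> []"
| step: "voracious_word W S B g (u @ v)"
    if "g \<in> carrier W" and "g \<noteq> \<one>\<^bsub>W\<^esub>"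
      and "voracious_word W S B (voracious_proj W S B g) u"
      and "is_arg_min length
             (\<lambda>v. v \<in> lists S \<and> word_eval W v = inv\<^bsub>W\<^esub> (voracious_proj W S B g) \<otimes>\<^bsub>W\<^esub> g) v"

definition voracious_language ::
    "('a, 'b) monoid_scheme \<Rightarrow> 'a set \<Rightarrow> 'a set \<Rightarrow> 'a list set" where
  "voracious_language W S B = (\<Union>g \<in> carrier W. {w. voracious_word W S B g w})"


section \<open>Biautomatic structures\<close>

text \<open>Acceptance by a deterministic finite automaton with state set \<open>Q\<close>, transition function \<open>\<delta>\<close>,
  initial state \<open>q0\<close> and accepting states \<open>F\<close>. States may be taken to be natural numbers, since
  any finite state set can be renamed.\<close>

definition regular_language :: "'a set \<Rightarrow> 'a list set \<Rightarrow> bool" where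
  "regular_language S L \<longleftrightarrow>
     (\<exists>(Q :: nat set) (\<delta> :: nat \<Rightarrow> 'a \<Rightarrow> nat) q0 F.
        finite Q \<and> q0 \<in> Q \<and> F \<subseteq> Q \<and> (\<forall>q \<in> Q. \<forall>a \<in> S. \<delta> q a \<in> Q) \<and>
        L = {w \<in> lists S. foldl \<delta> q0 w \<in> F})"

text \<open>\<open>take i v\<close> is the prefix \<open>v(i)\<close>; it equals \<open>v\<close> once \<open>i\<close> reaches the length of \<open>v\<close>.\<close>

definition biautomatic_structure ::
    "('a, 'b) monoid_scheme \<Rightarrow> 'a set \<Rightarrow> 'a list set \<Rightarrow> bool" where
  "biautomatic_structure G S L \<longleftrightarrow>
     finite S \<and> S \<subseteq> carrier G \<and> generate G S = carrier G \<and> (\<forall>s \<in> S. inv\<^bsub>G\<^esub> s \<in> S) \<and>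
     L \<subseteq> lists S \<and> regular_language S L \<and>
     (\<forall>g \<in> carrier G. \<exists>v \<in> L. word_eval G v = g) \<and>
     (\<exists>C. \<forall>v \<in> L. \<forall>v' \<in> L. \<forall>s \<in> S. word_eval G v' = word_eval G v \<otimes>\<^bsub>G\<^esub> s \<longrightarrow>
        (\<forall>i \<ge> 1. word_dist G S (word_eval G (take i v)) (word_eval G (take i v')) \<le> C)) \<and>
     (\<exists>C'. \<forall>v \<in> L. \<forall>v' \<in> L. \<forall>s \<in> S. word_eval G v' = s \<otimes>\<^bsub>G\<^esub> word_eval G v \<longrightarrow>
        (\<forall>i \<ge> 1. word_dist G S (s \<otimes>\<^bsub>G\<^esub> word_eval G (take i v)) (word_eval G (take i v')) \<le> C'))"

end

theory Submission
  imports Defs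
begin

text \<open>
  Write \<open>\<nu>\<close> for the voracious projection and \<open>M\<close> for the largest length in \<open>B\<close>. The geometric
  input is one fact about walls, \<open>wall_crossing\<close>: an edge from \<open>g\<close> to \<open>g t\<close> whose ends lie on different
  sides of the wall of \<open>s \<in> S\<close> satisfies \<open>s g = g t\<close>. It follows from the presentation by counting
  modulo 2 how often a path crosses a wall. It also gives the joins of bounded pairs in the right
  weak order (\<open>join_exists\<close>), so that the projection \<open>\<pi>\<close> to \<open>B\<close> picks the greatest element of \<open>B\<close>
  below its argument.

  Voracious words are geodesics that pass through the iterates \<open>\<nu>\<^sup>k g\<close>, at most \<open>M\<close> apart, so it
  suffices to compare these iterates (\<open>fellow_travel\<close>). If \<open>g s\<close> is longer than \<open>g\<close>, then
  \<open>\<nu> g \<preceq> \<nu> (g s) \<preceq> g\<close> (\<open>vor_edge\<close>), and \<open>\<nu>\<close> is monotone; hence \<open>\<nu>\<^sup>k g\<close> and \<open>\<nu>\<^sup>k (g s)\<close> are at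
  most \<open>M\<close> apart, and \<open>\<nu>\<^sup>k\<close> is Lipschitz with constant \<open>M\<close>.

  For left multiplication, let \<open>g\<close> be on the identity side of the wall of \<open>s\<close>. If no element of \<open>B\<close>
  crosses the wall on the way from \<open>g\<close> to \<open>s\<close>, then \<open>\<nu> (s g) = s \<nu> g\<close>. Otherwise \<open>g\<close> and \<open>s g\<close> are
  at most \<open>2 M\<close> apart, and since \<open>B\<close> is closed under suffixes the same alternative holds for \<open>\<nu> g\<close>
  (\<open>wall_in_reach_vor\<close>), hence for all further iterates. The Lipschitz bound then compares
  \<open>s \<nu>\<^sup>k g\<close> with \<open>\<nu>\<^sup>k (s g)\<close> by way of \<open>\<nu>\<^sup>k g\<close> (\<open>dist_vor_pow_generator_mult\<close>).

  For regularity, read the inverse of a voracious word as a product of elements of \<open>B\<close>, each the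
  projection of the product that it starts. Whether a product \<open>c x\<close> is reduced with projection \<open>c\<close>
  depends only on \<open>c\<close> and \<open>\<pi> x\<close> (\<open>vor_block_iff\<close>), so a word is checked block by block with finite
  memory.
\<close>


section \<open>Words and lengths in a Coxeter system\<close>

text \<open>The word \<open>s t s t \<dots>\<close> of length \<open>n\<close>.\<close>

primrec alternating_word :: "'a \<Rightarrow> 'a \<Rightarrow> nat \<Rightarrow> 'a list" where
  "alternating_word s t 0 = []"
| "alternating_word s t (Suc n) = s # alternating_word t s n"

lemma length_alternating_word [simp]: "length (alternating_word s t n) = n"
  by (induction n arbitrary: s t) auto

lemma alternating_word_in_lists:
  "s \<in> S \<Longrightarrow> t \<in> S \<Longrightarrow> alternating_word s t n \<in> lists S"
  by (induction n arbitrary: s t) auto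

lemma alternating_word_snoc:
  "alternating_word s t (Suc n) = alternating_word s t n @ [if even n then s else t]"
  by (induction n arbitrary: s t) auto

lemma alternating_word_add:
  "\<exists>v. alternating_word s t (m + n) = alternating_word s t m @ v \<and> length v = n"
proof (induction n)
  case (Suc n)
  then show ?case
    by (metis add_Suc_right alternating_word_snoc append.assoc length_append_singleton)
qed simp

lemma concat_replicate_pair:
  "concat (replicate n [s, t]) = alternating_word s t (2 * n)"
  by (induction n) auto

text \<open>A word \<open>a\<^sub>1 \<dots> a\<^sub>n\<close> is read as an edge path that starts at the identity of the Cayley graph.
  Its \<open>i\<close>-th edge crosses the wall of the reflection \<open>a\<^sub>1 \<dots> a\<^sub>i \<dots> a\<^sub>1\<close>. The predicate says that the
  path crosses the wall of \<open>x\<close> an odd number of times. The recursion moves the start of the tail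
  back to the identity, which conjugates \<open>x\<close> by the first letter \<open>a\<close>; generators are involutions,
  so \<open>a x a\<close> is this conjugate.\<close>

primrec odd_crossing :: "('a, 'b) monoid_scheme \<Rightarrow> 'a list \<Rightarrow> 'a \<Rightarrow> bool" where
  "odd_crossing G [] x = False"
| "odd_crossing G (a # w) x = ((x = a) \<noteq> odd_crossing G w (a \<otimes>\<^bsub>G\<^esub> x \<otimes>\<^bsub>G\<^esub> a))"

locale coxeter =
  fixes W :: "('a, 'b) monoid_scheme" (structure) and S :: "'a set"
  assumes cox: "coxeter_system W S"

sublocale coxeter \<subseteq> group W
  using cox by (simp add: coxeter_system_def)

context coxeter
begin

abbreviation ev :: "'a list \<Rightarrow> 'a" where "ev \<equiv> word_eval W"
abbreviation len :: "'a \<Rightarrow> nat" where "len \<equiv> word_length W S"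

lemma generator_closed [simp]: "s \<in> S \<Longrightarrow> s \<in> carrier W"
  using cox by (auto simp: coxeter_system_def)

lemma lists_carrier [simp]: "w \<in> lists S \<Longrightarrow> w \<in> lists (carrier W)"
  by (auto simp: in_lists_conv_set)

lemma inv_mult_cancel [simp]:
  "x \<in> carrier W \<Longrightarrow> y \<in> carrier W \<Longrightarrow> inv x \<otimes> (x \<otimes> y) = y"
  "x \<in> carrier W \<Longrightarrow> y \<in> carrier W \<Longrightarrow> x \<otimes> (inv x \<otimes> y) = y"
  by (simp_all flip: m_assoc)

lemma ev_Nil [simp]: "ev [] = \<one>"
  and ev_Cons [simp]: "ev (a # w) = a \<otimes> ev w"
  by (simp_all add: word_eval_def)

lemma ev_closed [simp]: "w \<in> lists (carrier W) \<Longrightarrow> ev w \<in> carrier W"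
  by (induction w) auto

lemma ev_append [simp]:
  "u \<in> lists (carrier W) \<Longrightarrow> v \<in> lists (carrier W) \<Longrightarrow> ev (u @ v) = ev u \<otimes> ev v"
  by (induction u) (auto simp: m_assoc)

lemma obtain_presentation:
  obtains m where
    "\<And>u v. u \<in> lists S \<Longrightarrow> v \<in> lists S \<Longrightarrow> ev u = ev v \<longleftrightarrow> coxeter_congruent S m u v"
  using cox unfolding coxeter_system_def by metis

lemma congruent_delete:
  assumes "u \<in> lists S" "v \<in> lists S" "r \<in> coxeter_relators S m"
  shows "coxeter_congruent S m (u @ r @ v) (u @ v)"
  unfolding coxeter_congruent_def using assms by (intro r_into_equivclp) blast

lemma relatorE:
  assumes "r \<in> coxeter_relators S m"
  obtains s where "s \<in> S" "r = [s, s]"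
    | s t n where "s \<in> S" "t \<in> S" "r = alternating_word s t (2 * n)"
  using assms by (auto simp: coxeter_relators_def concat_replicate_pair)

lemma relator_in_lists: "r \<in> coxeter_relators S m \<Longrightarrow> r \<in> lists S"
  by (erule relatorE) (simp_all add: alternating_word_in_lists)

lemma generator_square [simp]:
  assumes "s \<in> S" shows "s \<otimes> s = \<one>"
proof -
  obtain m where m: "\<And>u v. u \<in> lists S \<Longrightarrow> v \<in> lists S \<Longrightarrow> ev u = ev v \<longleftrightarrow> coxeter_congruent S m u v"
    using obtain_presentation by blast
  have "[s, s] \<in> coxeter_relators S m"
    using assms by (auto simp: coxeter_relators_def)
  then have "coxeter_congruent S m [s, s] []"
    using congruent_delete[of "[]" "[]" "[s, s]" m] by simp
  then have "ev [s, s] = ev []"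
    using m[of "[s, s]" "[]"] assms by simp
  then show ?thesis using assms by simp
qed

lemma generator_inv [simp]: "s \<in> S \<Longrightarrow> inv s = s"
  by (simp add: inv_equality)

lemma generator_cancel [simp]: "s \<in> S \<Longrightarrow> x \<in> carrier W \<Longrightarrow> s \<otimes> (s \<otimes> x) = x"
  by (simp flip: m_assoc)

lemma ev_rev: "w \<in> lists S \<Longrightarrow> ev (rev w) = inv (ev w)"
proof (induction w)
  case (Cons a w)
  then have "rev w \<in> lists S" by (simp add: in_lists_conv_set)
  then show ?case using Cons by (simp add: inv_mult_group)
qed simp

lemma obtain_word:
  assumes "g \<in> carrier W" obtains w where "w \<in> lists S" "ev w = g"
proof -
  have "g \<in> generate W S"
    using assms cox by (simp add: coxeter_system_def)
  then have "\<exists>w \<in> lists S. ev w = g"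
  proof (induction rule: generate.induct)
    case one
    then show ?case by (intro bexI[of _ "[]"]) auto
  next
    case (incl h)
    then show ?case by (intro bexI[of _ "[h]"]) auto
  next
    case (inv h)
    then show ?case by (intro bexI[of _ "[h]"]) auto
  next
    case (eng g h)
    then obtain u v where "u \<in> lists S" "ev u = g" "v \<in> lists S" "ev v = h" by blast
    then show ?case by (intro bexI[of _ "u @ v"]) auto
  qed
  then show thesis using that by blast
qed

lemma len_ev_le: "w \<in> lists S \<Longrightarrow> len (ev w) \<le> length w"
  unfolding word_length_def by (rule Least_le) blast

lemma obtain_reduced_word:
  assumes "g \<in> carrier W" obtains w where "w \<in> lists S" "ev w = g" "length w = len g"
proof -
  have "\<exists>n. \<exists>w \<in> lists S. length w = n \<and> ev w = g"
    using obtain_word[OF assms] by metis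
  from LeastI_ex[OF this] show thesis
    using that by (auto simp: word_length_def)
qed

lemma len_one [simp]: "len \<one> = 0"
  using len_ev_le[of "[]"] by simp

lemma len_eq_0_iff: "g \<in> carrier W \<Longrightarrow> len g = 0 \<longleftrightarrow> g = \<one>"
  by (metis obtain_reduced_word len_one ev_Nil length_0_conv)

lemma len_mult_le:
  assumes "g \<in> carrier W" "h \<in> carrier W" shows "len (g \<otimes> h) \<le> len g + len h"
proof -
  obtain u v where "u \<in> lists S" "ev u = g" "length u = len g" "v \<in> lists S" "ev v = h" "length v = len h"
    using obtain_reduced_word assms by metis
  then show ?thesis using len_ev_le[of "u @ v"] by simp
qed

lemma len_inv [simp]:
  assumes "g \<in> carrier W" shows "len (inv g) = len g"
proof -
  have *: "len (inv g) \<le> len g" if g: "g \<in> carrier W" for g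
  proof -
    obtain w where "w \<in> lists S" "ev w = g" "length w = len g"
      using obtain_reduced_word[OF g] .
    then show ?thesis using len_ev_le[of "rev w"] ev_rev[of w] by (simp add: in_lists_conv_set)
  qed
  show ?thesis using *[OF assms] *[of "inv g"] assms by simp
qed

lemma len_generator_le: "s \<in> S \<Longrightarrow> len s \<le> 1"
  using len_ev_le[of "[s]"] by simp


section \<open>Walls and the exchange condition\<close>

lemma odd_crossing_append:
  assumes "u \<in> lists S" "x \<in> carrier W"
  shows "odd_crossing W (u @ v) x \<longleftrightarrow>
    odd_crossing W u x \<noteq> odd_crossing W v (inv (ev u) \<otimes> x \<otimes> ev u)"
  using assms
proof (induction u arbitrary: x)
  case (Cons a u)
  then have "inv (ev (a # u)) \<otimes> x \<otimes> ev (a # u) = inv (ev u) \<otimes> (a \<otimes> x \<otimes> a) \<otimes> ev u"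
    by (simp add: inv_mult_group m_assoc)
  then show ?case using Cons by (cases "x = a") simp_all
qed simp

lemma pow_mult_swap:
  assumes "s \<in> carrier W" "t \<in> carrier W"
  shows "(s \<otimes> t) [^] (j::nat) \<otimes> s = s \<otimes> (t \<otimes> s) [^] j"
proof (induction j)
  case (Suc j)
  have "(s \<otimes> t) [^] Suc j \<otimes> s = ((s \<otimes> t) [^] j \<otimes> s) \<otimes> (t \<otimes> s)"
    using assms by (simp add: m_assoc)
  then show ?case unfolding Suc using assms by (simp add: m_assoc)
qed (use assms in simp)

text \<open>The edges of an alternating path cross the walls of the reflections \<open>(s t)\<^sup>j s\<close>.\<close>

lemma odd_crossing_alternating_word:
  assumes "s \<in> S" "t \<in> S" "x \<in> carrier W"
  shows "odd_crossing W (alternating_word s t n) x \<longleftrightarrow>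
    odd (card {j. j < n \<and> (s \<otimes> t) [^] j \<otimes> s = x})"
  using assms
proof (induction n arbitrary: s t x)
  case (Suc n)
  let ?A = "{j. j < n \<and> (t \<otimes> s) [^] j \<otimes> t = s \<otimes> x \<otimes> s}"
  have shift: "(t \<otimes> s) [^] j \<otimes> t = s \<otimes> x \<otimes> s \<longleftrightarrow> (s \<otimes> t) [^] Suc j \<otimes> s = x" for j :: nat
  proof -
    have "(s \<otimes> t) [^] Suc j \<otimes> s = s \<otimes> ((t \<otimes> s) [^] j \<otimes> t) \<otimes> s"
      using Suc.prems pow_mult_swap[of s t j] by (simp add: m_assoc flip: m_assoc[of "(s \<otimes> t) [^] j" s])
    moreover have "s \<otimes> y \<otimes> s = x \<longleftrightarrow> y = s \<otimes> x \<otimes> s" if "y \<in> carrier W" for y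
      using that Suc.prems by (auto simp: m_assoc)
    ultimately show ?thesis using Suc.prems by simp
  qed
  have "{j. j < Suc n \<and> (s \<otimes> t) [^] j \<otimes> s = x} = (if x = s then {0} else {}) \<union> Suc ` ?A"
    (is "?L = ?R")
  proof (rule Set.set_eqI)
    fix j show "j \<in> ?L \<longleftrightarrow> j \<in> ?R"
      using Suc.prems by (cases j) (auto simp: shift simp del: nat_pow_Suc)
  qed
  moreover have "card ((if x = s then {0} else {}) \<union> Suc ` ?A) = (if x = s then 1 else 0) + card ?A"
    by (subst card_Un_disjoint) (auto simp: card_image)
  ultimately show ?case using Suc.IH[of t s "s \<otimes> x \<otimes> s"] Suc.prems by simp
qed simp

lemma odd_crossing_relator:
  assumes r: "r \<in> coxeter_relators S m" and x: "x \<in> carrier W" and "ev r = \<one>"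
  shows "\<not> odd_crossing W r x"
  using r
proof (cases rule: relatorE)
  case 1
  then show ?thesis using x by (auto simp: m_assoc dest: inv_equality)
next
  case (2 s t n)
  have "ev (alternating_word s t (2 * n)) = (s \<otimes> t) [^] n" for n
  proof (induction n)
    case (Suc n)
    have "(s \<otimes> t) [^] Suc n = (s \<otimes> t) \<otimes> (s \<otimes> t) [^] n"
      using 2 by (intro nat_pow_Suc2) simp
    then show ?case using Suc 2 by (simp add: m_assoc)
  qed simp
  then have per: "(s \<otimes> t) [^] n = \<one>" using 2 \<open>ev r = \<one>\<close> by simp
  let ?A = "{j. j < n \<and> (s \<otimes> t) [^] j \<otimes> s = x}"
  have shift: "(s \<otimes> t) [^] (n + j) \<otimes> s = (s \<otimes> t) [^] j \<otimes> s" for j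
    using 2 per by (simp flip: nat_pow_mult)
  \<comment> \<open>The second half of the path crosses the same walls as the first half.\<close>
  have "{j. j < 2 * n \<and> (s \<otimes> t) [^] j \<otimes> s = x} = ?A \<union> (+) n ` ?A" (is "?L = ?R")
  proof (rule Set.set_eqI)
    fix j show "j \<in> ?L \<longleftrightarrow> j \<in> ?R"
    proof (cases "j < n")
      case False
      then obtain i where "j = n + i" using le_Suc_ex not_less by blast
      then show ?thesis by (auto simp: shift)
    qed auto
  qed
  moreover have "card (?A \<union> (+) n ` ?A) = card ?A + card ?A"
    by (subst card_Un_disjoint) (auto simp: card_image)
  ultimately show ?thesis
    using odd_crossing_alternating_word[of s t x "2 * n"] 2 x by simp
qed

text \<open>The parity of the crossings depends only on the end point of the path: deleting a relator
  deletes a closed path, which crosses each wall an even number of times.\<close>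

lemma odd_crossing_cong:
  assumes "u \<in> lists S" "v \<in> lists S" "ev u = ev v" "x \<in> carrier W"
  shows "odd_crossing W u x = odd_crossing W v x"
proof -
  obtain m where m: "\<And>u v. u \<in> lists S \<Longrightarrow> v \<in> lists S \<Longrightarrow> ev u = ev v \<longleftrightarrow> coxeter_congruent S m u v"
    using obtain_presentation by blast
  have del: "odd_crossing W (p @ r @ q) x = odd_crossing W (p @ q) x"
    if "p \<in> lists S" "q \<in> lists S" "r \<in> coxeter_relators S m" for p q r
  proof -
    have r: "r \<in> lists S" using relator_in_lists that(3) by blast
    have "ev (p @ r @ q) = ev (p @ q)"
      using congruent_delete[OF that] m[of "p @ r @ q" "p @ q"] that r
      by simp
    then have one: "ev r = \<one>"
      using that r by (simp add: m_assoc[symmetric])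
    have "\<not> odd_crossing W r (inv (ev p) \<otimes> x \<otimes> ev p)"
      using odd_crossing_relator[OF that(3) _ one] that assms(4) by simp
    then show ?thesis
      using that r assms(4) one by (simp add: odd_crossing_append m_assoc)
  qed
  have "coxeter_congruent S m u v" using m assms by blast
  then show ?thesis unfolding coxeter_congruent_def
    by (induction rule: equivclp_induct) (use del in auto)
qed

text \<open>An edge of \<open>w\<close> that crosses the wall of \<open>x\<close> can be deleted if the path before it is
  reflected by \<open>x\<close>; the result is a shorter word for \<open>x w\<close>.\<close>

lemma exchange_word:
  assumes "w \<in> lists S" "x \<in> carrier W" "odd_crossing W w x"
  shows "\<exists>w' \<in> lists S. length w' < length w \<and> ev w' = x \<otimes> ev w"
  using assms
proof (induction w arbitrary: x)
  case (Cons a w)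
  have a: "a \<in> S" "w \<in> lists S" using Cons.hyps by simp_all
  show ?case
  proof (cases "x = a")
    case True
    then show ?thesis using a by (intro bexI[of _ w]) simp_all
  next
    case False
    then have "\<exists>w' \<in> lists S. length w' < length w \<and> ev w' = a \<otimes> x \<otimes> a \<otimes> ev w"
      using a Cons.prems by (intro Cons.IH) simp_all
    then obtain w' where "w' \<in> lists S" "length w' < length w" "ev w' = a \<otimes> x \<otimes> a \<otimes> ev w"
      by blast
    then show ?thesis using a Cons.prems by (intro bexI[of _ "a # w'"]) (simp_all add: m_assoc)
  qed
qed simp

text \<open>A generator \<open>s\<close> shortens \<open>g\<close> from the left exactly if a path to \<open>g\<close> crosses the wall of
  \<open>s\<close> an odd number of times.\<close>

lemma left_descent_iff_odd_crossing:
  assumes s: "s \<in> S" and w: "w \<in> lists S"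
  shows "len (s \<otimes> ev w) < len (ev w) \<longleftrightarrow> odd_crossing W w s"
    and "len (s \<otimes> ev w) \<noteq> len (ev w)"
proof -
  have shorter: "len (s \<otimes> ev w) < len (ev w)" if odd: "odd_crossing W w s" and w: "w \<in> lists S" for w
  proof -
    obtain v where v: "v \<in> lists S" "ev v = ev w" "length v = len (ev w)"
      using obtain_reduced_word[of "ev w"] w by auto
    then have "odd_crossing W v s" using odd_crossing_cong[of v w s] odd w s by simp
    then obtain w' where "w' \<in> lists S" "length w' < length v" "ev w' = s \<otimes> ev v"
      using exchange_word[of v s] v s by auto
    then show ?thesis using len_ev_le[of w'] v by simp
  qed
  show "len (s \<otimes> ev w) < len (ev w) \<longleftrightarrow> odd_crossing W w s"
    and "len (s \<otimes> ev w) \<noteq> len (ev w)"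
    using shorter[of w] shorter[of "s # w"] s w
    by (cases "odd_crossing W w s"; simp add: m_assoc)+
qed

lemma len_generator_mult:
  assumes "s \<in> S" "g \<in> carrier W"
  shows "len (s \<otimes> g) = Suc (len g) \<or> len g = Suc (len (s \<otimes> g))"
proof -
  obtain w where "w \<in> lists S" "ev w = g" using obtain_word assms by blast
  then have "len (s \<otimes> g) \<noteq> len g" using left_descent_iff_odd_crossing(2) assms by blast
  moreover have "len (s \<otimes> g) \<le> Suc (len g)" "len g \<le> Suc (len (s \<otimes> g))"
    using len_mult_le[of s g] len_mult_le[of s "s \<otimes> g"] len_generator_le[of s] assms by simp_all
  ultimately show ?thesis by linarith
qed

lemma len_generator: "s \<in> S \<Longrightarrow> len s = 1"
  using len_generator_mult[of s \<one>] by simp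

text \<open>An edge whose ends lie on different sides of the wall of \<open>s\<close> is flipped by \<open>s\<close>.\<close>

lemma wall_crossing_edge:
  assumes s: "s \<in> S" and t: "t \<in> S" and g: "g \<in> carrier W"
    and "\<not> len (s \<otimes> g) < len g" "len (s \<otimes> (g \<otimes> t)) < len (g \<otimes> t)"
  shows "s \<otimes> g = g \<otimes> t"
proof -
  obtain w where w: "w \<in> lists S" "ev w = g" using obtain_word g by blast
  have "\<not> odd_crossing W w s" using left_descent_iff_odd_crossing(1)[OF s] w assms by blast
  moreover have "odd_crossing W (w @ [t]) s"
    using left_descent_iff_odd_crossing(1)[OF s, of "w @ [t]"] w t assms by simp
  ultimately have "inv g \<otimes> s \<otimes> g = t"
    using w s by (simp add: odd_crossing_append)
  then have "g \<otimes> (inv g \<otimes> s \<otimes> g) = g \<otimes> t" by simp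
  then show ?thesis using g s by (simp add: m_assoc)
qed


section \<open>Joins in the right weak order\<close>

text \<open>The product \<open>x y\<close> is reduced: concatenating geodesic words for \<open>x\<close> and \<open>y\<close> gives a
  geodesic word.\<close>

definition reduced :: "'a \<Rightarrow> 'a \<Rightarrow> bool" where
  "reduced x y \<longleftrightarrow> len (x \<otimes> y) = len x + len y"

text \<open>The right weak order as a binary relation; it agrees with the order of
  \<open>right_weak_order W S\<close>.\<close>

definition weak_le :: "'a \<Rightarrow> 'a \<Rightarrow> bool" (infix "\<preceq>" 50) where
  "x \<preceq> y \<longleftrightarrow> len y = len x + len (inv x \<otimes> y)"

lemma weak_le_mult_iff: "x \<in> carrier W \<Longrightarrow> y \<in> carrier W \<Longrightarrow> x \<preceq> x \<otimes> y \<longleftrightarrow> reduced x y"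
  by (simp add: weak_le_def reduced_def)

lemma weak_leE:
  assumes "x \<preceq> z" "x \<in> carrier W" "z \<in> carrier W"
  obtains y where "y \<in> carrier W" "z = x \<otimes> y" "reduced x y"
  using that[of "inv x \<otimes> z"] assms by (simp add: weak_le_def reduced_def)

lemma reduced_assoc:
  assumes "x \<in> carrier W" "y \<in> carrier W" "z \<in> carrier W"
  shows "reduced x y \<and> reduced (x \<otimes> y) z \<longleftrightarrow> reduced y z \<and> reduced x (y \<otimes> z)"
  using assms len_mult_le[of x y] len_mult_le[of y z]
    len_mult_le[of "x \<otimes> y" z] len_mult_le[of x "y \<otimes> z"]
  by (auto simp: reduced_def m_assoc)

lemma reduced_inv:
  assumes "x \<in> carrier W" "y \<in> carrier W"
  shows "reduced (inv y) (inv x) \<longleftrightarrow> reduced x y"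
  using assms len_inv[of "x \<otimes> y"] by (simp add: reduced_def inv_mult_group add.commute del: len_inv)
    (simp add: inv_mult_group)

lemma weak_le_refl [simp]: "x \<in> carrier W \<Longrightarrow> x \<preceq> x"
  by (simp add: weak_le_def)

lemma one_weak_le [simp]: "x \<in> carrier W \<Longrightarrow> \<one> \<preceq> x"
  by (simp add: weak_le_def)

lemma weak_le_len: "x \<preceq> y \<Longrightarrow> len x \<le> len y"
  by (simp add: weak_le_def)

lemma weak_le_trans:
  assumes "x \<preceq> y" "y \<preceq> z" "x \<in> carrier W" "y \<in> carrier W" "z \<in> carrier W"
  shows "x \<preceq> z"
proof -
  obtain a where a: "a \<in> carrier W" "y = x \<otimes> a" "reduced x a"
    using weak_leE[OF assms(1,3,4)] .
  obtain b where b: "b \<in> carrier W" "z = y \<otimes> b" "reduced y b"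
    using weak_leE[OF assms(2,4,5)] .
  have "reduced x (a \<otimes> b)" using reduced_assoc[of x a b] a b assms by simp
  then show ?thesis using a b assms by (simp add: m_assoc weak_le_mult_iff)
qed

lemma weak_le_len_eq:
  assumes "x \<preceq> y" "len y \<le> len x" "x \<in> carrier W" "y \<in> carrier W"
  shows "x = y"
proof -
  obtain a where a: "a \<in> carrier W" "y = x \<otimes> a" "reduced x a"
    using weak_leE[OF assms(1,3,4)] .
  then have "a = \<one>" using assms by (simp add: reduced_def flip: len_eq_0_iff)
  then show ?thesis using a assms by simp
qed

lemma weak_le_antisym:
  "x \<preceq> y \<Longrightarrow> y \<preceq> x \<Longrightarrow> x \<in> carrier W \<Longrightarrow> y \<in> carrier W \<Longrightarrow> x = y"
  by (blast intro: weak_le_len_eq weak_le_len)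

lemma reduced_mult_mono:
  assumes "reduced c x" "y \<preceq> x" "c \<in> carrier W" "x \<in> carrier W" "y \<in> carrier W"
  shows "reduced c y" "c \<otimes> y \<preceq> c \<otimes> x"
proof -
  obtain z where z: "z \<in> carrier W" "x = y \<otimes> z" "reduced y z"
    using weak_leE[OF assms(2,5,4)] .
  then have "reduced c y \<and> reduced (c \<otimes> y) z" using reduced_assoc[of c y z] assms by simp
  then show "reduced c y" "c \<otimes> y \<preceq> c \<otimes> x"
    using z assms by (simp_all add: weak_le_mult_iff flip: m_assoc)
qed

lemma reduced_mult_cancel:
  assumes "reduced c y" "c \<otimes> y \<preceq> c \<otimes> x" "c \<in> carrier W" "x \<in> carrier W" "y \<in> carrier W"
  shows "y \<preceq> x" "reduced c x"
proof -
  obtain z where z: "z \<in> carrier W" "c \<otimes> x = c \<otimes> y \<otimes> z" "reduced (c \<otimes> y) z"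
    using weak_leE[OF assms(2)] assms by auto
  then have "x = y \<otimes> z" using assms by (simp add: m_assoc)
  moreover have "reduced y z \<and> reduced c (y \<otimes> z)" using reduced_assoc[of c y z] assms z by simp
  ultimately show "y \<preceq> x" "reduced c x"
    using z assms by (simp_all add: weak_le_mult_iff)
qed

lemma generator_weak_le_iff:
  assumes "s \<in> S" "g \<in> carrier W" shows "s \<preceq> g \<longleftrightarrow> len (s \<otimes> g) < len g"
  using len_generator_mult[OF assms] len_generator[of s] assms by (auto simp: weak_le_def)

lemma len_generator_mult_if:
  assumes "s \<in> S" "g \<in> carrier W"
  shows "len (s \<otimes> g) = (if s \<preceq> g then len g - 1 else len g + 1)"
  using len_generator_mult[OF assms] generator_weak_le_iff[OF assms] by auto

lemma reduced_generator_iff: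
  assumes "s \<in> S" "g \<in> carrier W" shows "reduced s g \<longleftrightarrow> \<not> s \<preceq> g"
  using len_generator_mult[OF assms] generator_weak_le_iff[OF assms] len_generator[of s] assms
  by (auto simp: reduced_def)

lemma reduced_generator_cancel:
  assumes "s \<in> S" "g \<in> carrier W" "s \<preceq> g" shows "reduced s (s \<otimes> g)"
  using assms len_generator_mult_if[of s g] len_generator_mult[of s g] len_generator[of s]
  by (auto simp: reduced_def)

lemma wall_crossing:
  assumes "s \<in> S" "t \<in> S" "g \<in> carrier W" "\<not> s \<preceq> g" "s \<preceq> g \<otimes> t"
  shows "s \<otimes> g = g \<otimes> t"
  using wall_crossing_edge[of s t g] assms by (simp add: generator_weak_le_iff)

lemma obtain_left_descent:
  assumes "g \<in> carrier W" "g \<noteq> \<one>" obtains s where "s \<in> S" "s \<preceq> g"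
proof -
  obtain w where w: "w \<in> lists S" "ev w = g" "length w = len g"
    using obtain_reduced_word[OF assms(1)] .
  with assms obtain s v where sv: "w = s # v" by (cases w) auto
  then have mem: "s \<in> S" "v \<in> lists S" using w by simp_all
  then have "s \<otimes> g = ev v" using w sv by (metis ev_Cons ev_closed generator_cancel lists_carrier)
  then have "len (s \<otimes> g) < len g"
    using w sv len_ev_le[OF mem(2)] by simp
  then show thesis using that generator_weak_le_iff[of s g] mem assms by simp
qed

text \<open>Induction along a geodesic from \<open>g\<close> to \<open>h\<close>.\<close>

lemma weak_le_induct [consumes 3, case_names base step]:
  assumes "g \<preceq> h" "g \<in> carrier W" "h \<in> carrier W" and "P g"
    and step: "\<And>y r. y \<in> carrier W \<Longrightarrow> r \<in> S \<Longrightarrow> g \<preceq> y \<Longrightarrow> reduced y r \<Longrightarrow> P y \<Longrightarrow> P (y \<otimes> r)"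
  shows "P h"
proof -
  have *: "P (g \<otimes> ev w)" if "w \<in> lists S" "len (g \<otimes> ev w) = len g + length w" for w
    using that
  proof (induction w rule: rev_induct)
    case Nil
    then show ?case using assms by simp
  next
    case (snoc r w)
    have mem: "w \<in> lists S" "r \<in> S" using snoc.prems(1) by simp_all
    define y where "y = g \<otimes> ev w"
    have y: "y \<in> carrier W" using mem assms by (simp add: y_def)
    have yr: "g \<otimes> ev (w @ [r]) = y \<otimes> r" using mem assms by (simp add: y_def m_assoc)
    have len_y: "len y = len g + length w"
      using snoc.prems(2) len_mult_le[of y r] len_mult_le[of g "ev w"] len_ev_le[of w]
        len_generator[of r] mem assms y unfolding yr by (simp add: y_def)
    have "reduced y r"
      using snoc.prems(2) len_y len_generator[of r] mem y unfolding yr by (simp add: reduced_def)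
    moreover have "g \<preceq> y"
      using len_y len_ev_le[of w] len_mult_le[of g "ev w"] assms mem
      by (simp add: y_def weak_le_def)
    moreover have "P y" using snoc.IH mem len_y by (simp add: y_def)
    ultimately show ?case using step mem y yr by simp
  qed
  obtain y where y: "y \<in> carrier W" "h = g \<otimes> y" "reduced g y"
    using weak_leE[OF assms(1-3)] .
  obtain w where "w \<in> lists S" "ev w = y" "length w = len y"
    using obtain_reduced_word[OF y(1)] .
  then show ?thesis using *[of w] y by (simp add: reduced_def)
qed

text \<open>A lifting property: a geodesic from \<open>a\<close> to \<open>z\<close> crosses the wall of \<open>t\<close>, and the mirror image
  of its part before the crossing leads from \<open>t a\<close> to the far end of the crossed edge, one step
  shorter than from \<open>a\<close>.\<close>

lemma generator_mult_weak_le: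
  assumes t: "t \<in> S" and a: "a \<in> carrier W" and z: "z \<in> carrier W"
    and "a \<preceq> z" "t \<preceq> z" "\<not> t \<preceq> a"
  shows "t \<otimes> a \<preceq> z"
  using \<open>a \<preceq> z\<close> a z \<open>t \<preceq> z\<close>
proof (induction rule: weak_le_induct)
  case base
  then show ?case using assms by simp
next
  case (step y r)
  show ?case
  proof (cases "t \<preceq> y")
    case True
    then have "t \<otimes> a \<preceq> y" using step by blast
    moreover have "y \<preceq> y \<otimes> r" using step by (simp add: weak_le_mult_iff)
    ultimately show ?thesis using weak_le_trans[of "t \<otimes> a" y "y \<otimes> r"] t a step by simp
  next
    case False
    then have "t \<otimes> y = y \<otimes> r" using wall_crossing[of t r y] t step by simp
    moreover have "reduced t y" using False reduced_generator_iff t step by blast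
    ultimately show ?thesis using reduced_mult_mono(2)[of t y a] t a step by simp
  qed
qed

lemma alternating_prefix:
  assumes "s \<in> S" "t \<in> S" "len (ev (alternating_word s t n)) = n" "m \<le> n"
  shows "len (ev (alternating_word s t m)) = m"
    and "ev (alternating_word s t m) \<preceq> ev (alternating_word s t n)"
proof -
  obtain v where v: "alternating_word s t n = alternating_word s t m @ v" "length v = n - m"
    using alternating_word_add[of s t m "n - m"] assms by auto
  have mem: "alternating_word s t m \<in> lists S" "v \<in> lists S"
    using alternating_word_in_lists[of s S t n] alternating_word_in_lists[of s S t m] v assms
    by simp_all
  note len_ev_le[OF mem(1)] len_ev_le[OF mem(2)]
    len_mult_le[of "ev (alternating_word s t m)" "ev v"]
  then show "len (ev (alternating_word s t m)) = m"
    and "ev (alternating_word s t m) \<preceq> ev (alternating_word s t n)"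
    using v assms mem by (simp_all add: weak_le_def)
qed

text \<open>If a reduced alternating word also has the other generator as a left descent, then both
  alternating words of its length represent the same element.\<close>

lemma alternating_both_descents:
  assumes "s \<in> S" "t \<in> S" "len (ev (alternating_word s t n)) = n"
    and "t \<preceq> ev (alternating_word s t n)"
  shows "ev (alternating_word s t n) = ev (alternating_word t s n)"
  using assms
proof (induction n)
  case (Suc n)
  define r where "r = (if even n then s else t)"
  define u where "u = ev (alternating_word s t n)"
  have r: "r \<in> S" and u: "u \<in> carrier W"
    using Suc.prems by (simp_all add: r_def u_def alternating_word_in_lists)
  have ur: "ev (alternating_word s t (Suc n)) = u \<otimes> r"
    using r alternating_word_in_lists[of s S t n] Suc.prems(1,2)
    by (simp add: alternating_word_snoc u_def r_def[symmetric] del: alternating_word.simps)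
  have len_u: "len u = n" using alternating_prefix(1)[of s t "Suc n" n] Suc.prems by (simp add: u_def)
  show ?case
  proof (cases "t \<preceq> u")
    case True
    then have n: "n \<noteq> 0" using len_u weak_le_len[of t u] len_generator[of t] Suc.prems(2) by auto
    then obtain k where k: "n = Suc k" by (cases n) auto
    \<comment> \<open>The word for \<open>u\<close> that begins with \<open>t\<close> ends with \<open>r\<close>, so \<open>u r\<close> is too short.\<close>
    have "u = ev (alternating_word t s n)"
      using Suc.IH True len_u Suc.prems(1,2) by (simp add: u_def)
    also have "\<dots> = ev (alternating_word t s k) \<otimes> r"
      using Suc.prems(1,2) alternating_word_in_lists[of t S s k] k
      by (simp add: alternating_word_snoc r_def del: alternating_word.simps)
    finally have "u \<otimes> r = ev (alternating_word t s k)"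
      using r Suc.prems(1,2) by (simp add: m_assoc alternating_word_in_lists)
    then have "len (u \<otimes> r) \<le> k"
      using len_ev_le[of "alternating_word t s k"] Suc.prems(1,2) by (simp add: alternating_word_in_lists)
    then show ?thesis using Suc.prems(3) ur k by simp
  next
    case False
    then have "t \<otimes> u = u \<otimes> r"
      using wall_crossing[of t r u] Suc.prems r u ur by simp
    then show ?thesis using ur by (simp add: u_def)
  qed
qed simp

text \<open>The longest alternating word below \<open>z\<close> has both descents, for otherwise the lifting property
  extends it by one letter on the left.\<close>

lemma alternating_below_both_descents:
  assumes "s \<in> S" "t \<in> S" "z \<in> carrier W" "s \<preceq> z" "t \<preceq> z"
  obtains n where "len (ev (alternating_word s t n)) = n"
    "s \<preceq> ev (alternating_word s t n)" "t \<preceq> ev (alternating_word s t n)"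
    "ev (alternating_word s t n) \<preceq> z"
proof -
  define P where "P s t n \<longleftrightarrow> len (ev (alternating_word s t n)) = n \<and> ev (alternating_word s t n) \<preceq> z"
    for s t :: 'a and n
  define Q where "Q n \<longleftrightarrow> P s t n \<or> P t s n" for n
  have bound: "n \<le> len z" if "Q n" for n
    using that by (auto simp: Q_def P_def dest!: weak_le_len)
  have "Q 1" using assms len_generator[of s] by (simp add: Q_def P_def)
  define n where "n = (GREATEST n. Q n)"
  have "Q n" unfolding n_def using GreatestI_nat[of Q 1 "len z"] bound \<open>Q 1\<close> by blast
  have max: "k \<le> n" if "Q k" for k
    unfolding n_def using Greatest_le_nat[of Q k "len z"] bound that by blast
  have n1: "1 \<le> n" using max[OF \<open>Q 1\<close>] .
  have main: "len (ev (alternating_word p q n)) = n" "p \<preceq> ev (alternating_word p q n)"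
      "q \<preceq> ev (alternating_word p q n)" "ev (alternating_word p q n) \<preceq> z"
    if p: "p \<in> S" and q: "q \<in> S" "q \<preceq> z" and P: "P p q n"
      and notP: "\<not> P q p (Suc n)" for p q
  proof -
    let ?a = "ev (alternating_word p q n)"
    have a: "?a \<in> carrier W" using p q by (simp add: alternating_word_in_lists)
    show len: "len ?a = n" and le: "?a \<preceq> z" using P by (simp_all add: P_def)
    show "p \<preceq> ?a" using alternating_prefix(2)[OF p q(1) len n1] p by simp
    show "q \<preceq> ?a"
    proof (rule ccontr)
      assume q': "\<not> q \<preceq> ?a"
      then have "q \<otimes> ?a \<preceq> z" using generator_mult_weak_le[of q ?a z] p q a le assms by simp
      moreover have "len (q \<otimes> ?a) = Suc n" using len_generator_mult_if[of q ?a] q q' a len by simp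
      ultimately show False using notP by (simp add: P_def)
    qed
  qed
  have notP: "\<not> P s t (Suc n)" "\<not> P t s (Suc n)"
    using max[of "Suc n"] by (auto simp: Q_def)
  show thesis
  proof (cases "P s t n")
    case True
    then show thesis using that[of n] main[of s t] assms notP by blast
  next
    case False
    then have "P t s n" using \<open>Q n\<close> by (simp add: Q_def)
    note m = main[OF assms(2,1,4) this notP(1)]
    then have "ev (alternating_word t s n) = ev (alternating_word s t n)"
      using alternating_both_descents[of t s n] assms by blast
    then show thesis using that[of n] m by simp
  qed
qed

text \<open>The join of two distinct generators with a common upper bound is the longest element of the
  dihedral group that they generate, obtained here as the shortest reduced alternating word with
  both descents.\<close>

lemma generator_join:
  assumes "s \<in> S" "t \<in> S" "g \<in> carrier W" "s \<preceq> g" "t \<preceq> g"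
  obtains m where "m \<in> carrier W" "s \<preceq> m" "t \<preceq> m"
    "\<And>z. z \<in> carrier W \<Longrightarrow> s \<preceq> z \<Longrightarrow> t \<preceq> z \<Longrightarrow> m \<preceq> z"
proof -
  define P where "P n \<longleftrightarrow> len (ev (alternating_word s t n)) = n \<and>
    s \<preceq> ev (alternating_word s t n) \<and> t \<preceq> ev (alternating_word s t n)" for n
  have ex: "\<exists>n. P n \<and> ev (alternating_word s t n) \<preceq> z"
    if "z \<in> carrier W" "s \<preceq> z" "t \<preceq> z" for z
    using alternating_below_both_descents[OF assms(1,2) that] unfolding P_def by metis
  define n where "n = (LEAST n. P n)"
  have n: "P n" unfolding n_def using LeastI_ex[of P] ex assms by blast
  have "ev (alternating_word s t n) \<preceq> z" if z: "z \<in> carrier W" "s \<preceq> z" "t \<preceq> z" for z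
  proof -
    obtain k where k: "P k" "ev (alternating_word s t k) \<preceq> z" using ex z by blast
    then have "n \<le> k" unfolding n_def using Least_le by blast
    then have "ev (alternating_word s t n) \<preceq> ev (alternating_word s t k)"
      using alternating_prefix(2) k assms by (simp add: P_def)
    then show ?thesis
      using weak_le_trans[of _ "ev (alternating_word s t k)" z] k z assms
      by (simp add: alternating_word_in_lists)
  qed
  then show thesis using that[of "ev (alternating_word s t n)"] n assms
    by (simp add: P_def alternating_word_in_lists)
qed

text \<open>\<open>j\<close> is the least upper bound of \<open>x\<close> and \<open>y\<close> in the right weak order.\<close>

definition is_join :: "'a \<Rightarrow> 'a \<Rightarrow> 'a \<Rightarrow> bool" where
  "is_join x y j \<longleftrightarrow> j \<in> carrier W \<and> x \<preceq> j \<and> y \<preceq> j \<and>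
     (\<forall>z \<in> carrier W. x \<preceq> z \<longrightarrow> y \<preceq> z \<longrightarrow> j \<preceq> z)"

lemma is_join_generator_mult:
  assumes s: "s \<in> S" and x: "x \<in> carrier W" and y: "y \<in> carrier W" and g: "g \<in> carrier W"
    and "s \<preceq> x" "s \<preceq> y" "x \<preceq> g" and j: "is_join (s \<otimes> x) (s \<otimes> y) j" and "s \<otimes> x \<preceq> s \<otimes> g" "s \<otimes> y \<preceq> s \<otimes> g"
  shows "is_join x y (s \<otimes> j)"
proof -
  have jc: "j \<in> carrier W" using j by (simp add: is_join_def)
  note red = reduced_generator_cancel[OF s]
  have "s \<preceq> g" using weak_le_trans[of s x g] assms by simp
  then have "reduced s j"
    using reduced_mult_mono(1)[of s "s \<otimes> g" j] red j assms(9,10) s g jc by (simp add: is_join_def)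
  then have "s \<otimes> (s \<otimes> x) \<preceq> s \<otimes> j" "s \<otimes> (s \<otimes> y) \<preceq> s \<otimes> j"
    using reduced_mult_mono(2)[of s j "s \<otimes> x"] reduced_mult_mono(2)[of s j "s \<otimes> y"] j s x y
    by (simp_all add: is_join_def)
  moreover have "s \<otimes> j \<preceq> z" if z: "z \<in> carrier W" "x \<preceq> z" "y \<preceq> z" for z
  proof -
    have sz: "s \<preceq> z" using weak_le_trans[of s x z] assms z by simp
    have "s \<otimes> x \<preceq> s \<otimes> z" "s \<otimes> y \<preceq> s \<otimes> z"
      using reduced_mult_cancel(1)[of s "s \<otimes> x" "s \<otimes> z"] reduced_mult_cancel(1)[of s "s \<otimes> y" "s \<otimes> z"]
        red z s x y assms by simp_all
    then have "j \<preceq> s \<otimes> z" using j z s by (simp add: is_join_def)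
    then show ?thesis using reduced_mult_mono(2)[of s "s \<otimes> z" j] red[OF z(1) sz] s z jc by simp
  qed
  ultimately show ?thesis using s x y jc by (simp add: is_join_def)
qed

text \<open>Two elements that share a first letter are joined after this letter is removed, below a
  shorter element. Otherwise let \<open>m\<close> be the join of a first letter of \<open>x\<close> and one of \<open>y\<close>: then \<open>x\<close>
  and \<open>m\<close> share a letter, so do \<open>y\<close> and \<open>m\<close>, and so do the joins of these two pairs.\<close>

lemma join_exists:
  assumes "x \<in> carrier W" "y \<in> carrier W" "g \<in> carrier W" "x \<preceq> g" "y \<preceq> g"
  shows "\<exists>j. is_join x y j"
  using assms
proof (induction "len g" arbitrary: g x y rule: less_induct)
  case less
  have same: "\<exists>j. is_join a b j"
    if s: "s \<in> S" and ab: "a \<in> carrier W" "b \<in> carrier W" "s \<preceq> a" "s \<preceq> b" "a \<preceq> g" "b \<preceq> g" for s a b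
  proof -
    have g: "g \<in> carrier W" by fact
    have sg: "s \<preceq> g" using weak_le_trans[of s a g] s ab g by simp
    note red = reduced_generator_cancel[OF s]
    have le: "s \<otimes> a \<preceq> s \<otimes> g" "s \<otimes> b \<preceq> s \<otimes> g"
      using reduced_mult_cancel(1)[of s "s \<otimes> a" "s \<otimes> g"] reduced_mult_cancel(1)[of s "s \<otimes> b" "s \<otimes> g"]
        red s ab g by simp_all
    have "len (s \<otimes> g) < len g" using sg s g generator_weak_le_iff by blast
    then obtain j where "is_join (s \<otimes> a) (s \<otimes> b) j"
      using less.hyps[of "s \<otimes> g" "s \<otimes> a" "s \<otimes> b"] s ab g le by auto
    then show ?thesis using is_join_generator_mult[OF s] s ab g le by blast
  qed
  have join_le: "j \<preceq> g" if "is_join a b j" "a \<preceq> g" "b \<preceq> g" for a b j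
    using that less.prems(3) by (simp add: is_join_def)
  show ?case
  proof (cases "x = \<one> \<or> y = \<one>")
    case True
    then have "is_join x y y \<or> is_join x y x" using less.prems by (auto simp: is_join_def)
    then show ?thesis by blast
  next
    case False
    obtain s where s: "s \<in> S" "s \<preceq> x" using obtain_left_descent False less.prems by blast
    obtain t where t: "t \<in> S" "t \<preceq> y" using obtain_left_descent False less.prems by blast
    have sg: "s \<preceq> g" using weak_le_trans[of s x g] s less.prems by simp
    have tg: "t \<preceq> g" using weak_le_trans[of t y g] t less.prems by simp
    obtain m where m: "m \<in> carrier W" "s \<preceq> m" "t \<preceq> m"
        "\<And>z. z \<in> carrier W \<Longrightarrow> s \<preceq> z \<Longrightarrow> t \<preceq> z \<Longrightarrow> m \<preceq> z"
      using generator_join[OF s(1) t(1) less.prems(3) sg tg] by blast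
    have mg: "m \<preceq> g" using m less.prems sg tg by blast
    obtain a where a: "is_join x m a" using same[of s x m] s m mg less.prems by blast
    obtain b where b: "is_join y m b" using same[of t y m] t m mg less.prems by blast
    have ac: "a \<in> carrier W" and bc: "b \<in> carrier W" using a b by (simp_all add: is_join_def)
    have "s \<preceq> a" using weak_le_trans[of s m a] s m a ac by (simp add: is_join_def)
    moreover have "s \<preceq> b" using weak_le_trans[of s m b] s m b bc by (simp add: is_join_def)
    ultimately obtain j where j: "is_join a b j"
      using same[of s a b] join_le[OF a] join_le[OF b] s ac bc mg less.prems by blast
    have jc: "j \<in> carrier W" using j by (simp add: is_join_def)
    have "x \<preceq> j" using weak_le_trans[of x a j] a j ac jc less.prems by (simp add: is_join_def)
    moreover have "y \<preceq> j" using weak_le_trans[of y b j] b j bc jc less.prems by (simp add: is_join_def)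
    moreover have "j \<preceq> z" if z: "z \<in> carrier W" "x \<preceq> z" "y \<preceq> z" for z
    proof -
      have "s \<preceq> z" using weak_le_trans[of s x z] s z less.prems by simp
      moreover have "t \<preceq> z" using weak_le_trans[of t y z] t z less.prems by simp
      ultimately have "m \<preceq> z" using m z by blast
      then have "a \<preceq> z" "b \<preceq> z" using a b z by (simp_all add: is_join_def)
      then show ?thesis using j z by (simp add: is_join_def)
    qed
    ultimately have "is_join x y j" using jc by (simp add: is_join_def)
    then show ?thesis by blast
  qed
qed
end


section \<open>The projection to a Garside shadow\<close>

locale finite_garside_shadow = coxeter +
  fixes B :: "'a set"
  assumes shadow: "garside_shadow W S B" and finite_B: "finite B"
begin

abbreviation proj :: "'a \<Rightarrow> 'a" where "proj \<equiv> garside_proj W S B"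
abbreviation vor :: "'a \<Rightarrow> 'a" where "vor \<equiv> voracious_proj W S B"

lemma B_closed [simp]: "b \<in> B \<Longrightarrow> b \<in> carrier W"
  and generator_in_B [simp]: "s \<in> S \<Longrightarrow> s \<in> B"
  using shadow by (auto simp: garside_shadow_def)

lemma suffix_in_B:
  "u \<otimes> w \<in> B \<Longrightarrow> reduced u w \<Longrightarrow> u \<in> carrier W \<Longrightarrow> w \<in> carrier W \<Longrightarrow> w \<in> B"
  using shadow unfolding garside_shadow_def is_suffix_def reduced_def by blast

lemma le_right_weak_order [simp]: "x \<sqsubseteq>\<^bsub>right_weak_order W S\<^esub> y \<longleftrightarrow> x \<preceq> y"
  by (simp add: right_weak_order_def weak_le_def)

lemma carrier_right_weak_order [simp]: "carrier (right_weak_order W S) = carrier W"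
  by (simp add: right_weak_order_def)

lemma least_Upper_iff:
  "X \<subseteq> carrier W \<Longrightarrow>
    least (right_weak_order W S) j (Upper (right_weak_order W S) X) \<longleftrightarrow>
      j \<in> carrier W \<and> (\<forall>x \<in> X. x \<preceq> j) \<and>
      (\<forall>z \<in> carrier W. (\<forall>x \<in> X. x \<preceq> z) \<longrightarrow> j \<preceq> z)"
  by (simp add: least_def Upper_def) blast

lemma join_in_B:
  assumes "X \<subseteq> B" "j \<in> carrier W" "\<And>x. x \<in> X \<Longrightarrow> x \<preceq> j"
    and "\<And>z. z \<in> carrier W \<Longrightarrow> (\<And>x. x \<in> X \<Longrightarrow> x \<preceq> z) \<Longrightarrow> j \<preceq> z"
  shows "j \<in> B"
proof -
  have "X \<subseteq> carrier W" using assms(1) by auto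
  then have "least (right_weak_order W S) j (Upper (right_weak_order W S) X)"
    using assms by (simp add: least_Upper_iff)
  then show ?thesis using shadow assms(1) unfolding garside_shadow_def by blast
qed

lemma one_in_B [simp]: "\<one> \<in> B"
  by (rule join_in_B[of "{}"]) auto

lemma greatest_in_B_exists:
  assumes g: "g \<in> carrier W"
  shows "\<exists>p \<in> B. p \<preceq> g \<and> (\<forall>b \<in> B. b \<preceq> g \<longrightarrow> b \<preceq> p)"
proof -
  define A where "A = {b \<in> B. b \<preceq> g}"
  have A: "finite A" "\<one> \<in> A" using finite_B g by (simp_all add: A_def)
  then have "Max (len ` A) \<in> len ` A" by (intro Max_in) auto
  then obtain p where p: "p \<in> A" "len p = Max (len ` A)" by auto
  have max: "len b \<le> len p" if "b \<in> A" for b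
    using that A p by simp
  have "b \<preceq> p" if b: "b \<in> B" "b \<preceq> g" for b
  proof -
    obtain j where j: "is_join p b j"
      using join_exists[of p b g] b p g by (auto simp: A_def)
    have "j \<in> B"
      by (rule join_in_B[of "{p, b}"]) (use j b p in \<open>auto simp: A_def is_join_def\<close>)
    moreover have "j \<preceq> g" using j b p g by (simp add: is_join_def A_def)
    ultimately have "len j \<le> len p" using max by (simp add: A_def)
    then have "p = j" using weak_le_len_eq[of p j] j p by (simp add: is_join_def A_def)
    then show ?thesis using j by (simp add: is_join_def)
  qed
  then show ?thesis using p by (auto simp: A_def)
qed

text \<open>The projection of \<open>g\<close> is the greatest element of \<open>B\<close> below \<open>g\<close>.\<close>

lemma proj_eqI:
  assumes "p \<in> B" "p \<preceq> g" "\<And>b. b \<in> B \<Longrightarrow> b \<preceq> g \<Longrightarrow> b \<preceq> p"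
  shows "proj g = p"
proof -
  let ?L = "right_weak_order W S" and ?A = "{b \<in> B. b \<preceq> g}"
  have A: "?A \<subseteq> carrier W" by auto
  have "least ?L p (Upper ?L ?A)"
    using assms by (auto simp: least_Upper_iff[OF A])
  moreover have "x = p" if "least ?L x (Upper ?L ?A)" for x
    using that assms weak_le_antisym[of x p] by (auto simp: least_Upper_iff[OF A])
  ultimately have "(SOME x. least ?L x (Upper ?L ?A)) = p"
    by (rule some_equality)
  then show ?thesis by (simp add: garside_proj_def sup_def)
qed

lemma proj_in_B [simp]: "g \<in> carrier W \<Longrightarrow> proj g \<in> B"
  and proj_weak_le: "g \<in> carrier W \<Longrightarrow> proj g \<preceq> g"
  and weak_le_proj: "g \<in> carrier W \<Longrightarrow> b \<in> B \<Longrightarrow> b \<preceq> g \<Longrightarrow> b \<preceq> proj g"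
  using greatest_in_B_exists proj_eqI by metis+

text \<open>The largest length of an element of \<open>B\<close>.\<close>

definition shadow_radius :: nat where "shadow_radius = Max (len ` B)"

lemma len_B_le: "b \<in> B \<Longrightarrow> len b \<le> shadow_radius"
  unfolding shadow_radius_def using finite_B by simp

lemma proj_eq_one_iff:
  assumes "g \<in> carrier W" shows "proj g = \<one> \<longleftrightarrow> g = \<one>"
proof
  assume one: "proj g = \<one>"
  show "g = \<one>"
  proof (rule ccontr)
    assume "g \<noteq> \<one>"
    then obtain s where s: "s \<in> S" "s \<preceq> g" using obtain_left_descent assms by blast
    then have "s \<preceq> \<one>" using weak_le_proj[of g s] assms one by simp
    then show False using weak_le_len[of s \<one>] len_generator[of s] s by simp
  qed
next
  assume "g = \<one>"
  then show "proj g = \<one>"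
    using weak_le_len_eq[of "proj g" \<one>] weak_le_len[of "proj g" \<one>] proj_weak_le[of g] weak_le_len_eq[of \<one> "proj g"]
    by simp
qed


section \<open>The voracious projection\<close>

lemma vor_closed [simp]: "g \<in> carrier W \<Longrightarrow> vor g \<in> carrier W"
  by (simp add: voracious_proj_def)

lemma inv_eq_proj_mult:
  assumes "g \<in> carrier W"
  shows "inv g = proj (inv g) \<otimes> inv (vor g)" "reduced (proj (inv g)) (inv (vor g))"
proof -
  show *: "inv g = proj (inv g) \<otimes> inv (vor g)"
    using assms by (simp add: voracious_proj_def inv_mult_group)
  show "reduced (proj (inv g)) (inv (vor g))"
    using * proj_weak_le[of "inv g"] weak_le_mult_iff[of "proj (inv g)" "inv (vor g)"] assms by simp
qed

lemma eq_vor_mult: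
  assumes "g \<in> carrier W"
  shows "g = vor g \<otimes> inv (proj (inv g))" "reduced (vor g) (inv (proj (inv g)))"
  using assms reduced_inv[of "proj (inv g)" "inv (vor g)"] inv_eq_proj_mult[OF assms]
  by (simp_all add: voracious_proj_def m_assoc)

lemma vor_weak_le: "g \<in> carrier W \<Longrightarrow> vor g \<preceq> g"
  using eq_vor_mult[of g] weak_le_mult_iff[of "vor g" "inv (proj (inv g))"] by simp

lemma len_vor: "g \<in> carrier W \<Longrightarrow> len g = len (vor g) + len (proj (inv g))"
  using eq_vor_mult[of g] by (simp add: reduced_def)

lemma len_vor_less: "g \<in> carrier W \<Longrightarrow> g \<noteq> \<one> \<Longrightarrow> len (vor g) < len g"
  using len_vor[of g] len_eq_0_iff[of "proj (inv g)"] proj_eq_one_iff[of "inv g"] by simp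

lemma vor_one [simp]: "vor \<one> = \<one>"
  using proj_eq_one_iff[of \<one>] by (simp add: voracious_proj_def)

text \<open>The voracious projections of the two ends of an edge are interleaved: the projection of
  the longer end \<open>g s\<close> undoes \<open>s\<close> first, since \<open>s \<in> B\<close>, and the rest of its step is a suffix of an element of \<open>B\<close>,
  hence competes with the step taken from \<open>g\<close>.\<close>

lemma vor_edge:
  assumes g: "g \<in> carrier W" and s: "s \<in> S" and red: "reduced g s"
  shows "vor g \<preceq> vor (g \<otimes> s)" "vor (g \<otimes> s) \<preceq> g"
proof -
  define p where "p = proj (inv (g \<otimes> s))"
  have x: "inv (g \<otimes> s) = s \<otimes> inv g" using g s by (simp add: inv_mult_group)
  have red': "reduced s (inv g)" using reduced_inv[of g s] g s red by simp
  have p: "p \<in> B" "p \<preceq> s \<otimes> inv g"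
    using proj_weak_le[of "inv (g \<otimes> s)"] g s x by (simp_all add: p_def)
  have "s \<preceq> p"
    unfolding p_def x by (rule weak_le_proj) (use g s red' in \<open>simp_all add: weak_le_mult_iff\<close>)
  then obtain c where c: "c \<in> carrier W" "p = s \<otimes> c" "reduced s c"
    using weak_leE[of s p] s p by auto
  have cB: "c \<in> B" using suffix_in_B[of s c] c p s by simp
  have "c \<preceq> inv g" using reduced_mult_cancel(1)[of s c "inv g"] c p s g by simp
  then have "c \<preceq> proj (inv g)" using weak_le_proj cB g by simp
  then obtain e where e: "e \<in> carrier W" "proj (inv g) = c \<otimes> e" "reduced c e"
    using weak_leE[of c "proj (inv g)"] c g by auto
  define y where "y = inv (vor g)"
  have y: "y \<in> carrier W" "inv g = c \<otimes> e \<otimes> y" "reduced (c \<otimes> e) y"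
    using inv_eq_proj_mult[OF g] g e by (simp_all add: y_def)
  have ey: "reduced e y" "reduced c (e \<otimes> y)"
    using reduced_assoc[of c e y] c e y by simp_all
  have "vor (g \<otimes> s) = g \<otimes> c"
    using c g s by (simp add: voracious_proj_def p_def[symmetric] m_assoc)
  moreover have g_eq: "g = inv y \<otimes> inv e \<otimes> inv c"
    using y c e g inv_inv[of g] by (simp add: inv_mult_group m_assoc del: inv_inv)
  ultimately have vor_gs: "vor (g \<otimes> s) = inv y \<otimes> inv e" using c e y by (simp add: m_assoc)
  have "reduced (inv y) (inv e)" using ey reduced_inv[of e y] e y by simp
  then show "vor g \<preceq> vor (g \<otimes> s)"
    using vor_gs weak_le_mult_iff[of "inv y" "inv e"] e y g by (simp add: y_def)
  have "reduced (inv y \<otimes> inv e) (inv c)"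
    using ey reduced_inv[of c "e \<otimes> y"] e y c by (simp add: inv_mult_group)
  then show "vor (g \<otimes> s) \<preceq> g"
    using vor_gs weak_le_mult_iff[of "inv y \<otimes> inv e" "inv c"] g_eq e y c by simp
qed

lemma vor_mono:
  assumes "g \<preceq> h" "g \<in> carrier W" "h \<in> carrier W" shows "vor g \<preceq> vor h"
  using assms
proof (induction rule: weak_le_induct)
  case (step y r)
  then show ?case using vor_edge(1)[of y r] weak_le_trans[of "vor g" "vor y" "vor (y \<otimes> r)"] assms
    by simp
qed (use assms in simp)

lemma vor_pow_closed [simp]: "g \<in> carrier W \<Longrightarrow> (vor ^^ k) g \<in> carrier W"
  by (induction k) auto

lemma vor_pow_mono:
  "g \<preceq> h \<Longrightarrow> g \<in> carrier W \<Longrightarrow> h \<in> carrier W \<Longrightarrow> (vor ^^ k) g \<preceq> (vor ^^ k) h"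
  by (induction k) (auto intro: vor_mono)


section \<open>Iterated voracious projections of neighbours\<close>

abbreviation wdist :: "'a \<Rightarrow> 'a \<Rightarrow> nat" where "wdist \<equiv> word_dist W S"

lemma dist_triangle:
  assumes "x \<in> carrier W" "y \<in> carrier W" "z \<in> carrier W"
  shows "wdist x z \<le> wdist x y + wdist y z"
  using len_mult_le[of "inv x \<otimes> y" "inv y \<otimes> z"] assms by (simp add: word_dist_def m_assoc)

lemma dist_commute: "x \<in> carrier W \<Longrightarrow> y \<in> carrier W \<Longrightarrow> wdist x y = wdist y x"
  using len_inv[of "inv x \<otimes> y"] by (simp add: word_dist_def inv_mult_group del: len_inv)

lemma dist_mult_left:
  "z \<in> carrier W \<Longrightarrow> x \<in> carrier W \<Longrightarrow> y \<in> carrier W \<Longrightarrow> wdist (z \<otimes> x) (z \<otimes> y) = wdist x y"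
  by (simp add: word_dist_def inv_mult_group m_assoc)

lemma dist_self [simp]: "x \<in> carrier W \<Longrightarrow> wdist x x = 0"
  by (simp add: word_dist_def)

lemma weak_le_dist: "x \<preceq> y \<Longrightarrow> len y = len x + wdist x y"
  by (simp add: weak_le_def word_dist_def)

lemma len_le_dist: "x \<in> carrier W \<Longrightarrow> y \<in> carrier W \<Longrightarrow> len y \<le> len x + wdist x y"
  using len_mult_le[of x "inv x \<otimes> y"] by (simp add: word_dist_def)

text \<open>By interleaving, the \<open>k\<close>-th projection of the longer end lies between the \<open>k\<close>-th and the
  previous projection of the shorter end.\<close>

lemma dist_vor_pow_edge:
  assumes g: "g \<in> carrier W" and s: "s \<in> S"
  shows "wdist ((vor ^^ k) g) ((vor ^^ k) (g \<otimes> s)) \<le> shadow_radius"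
proof -
  have up: "wdist ((vor ^^ k) h) ((vor ^^ k) (h \<otimes> s)) \<le> shadow_radius"
    if h: "h \<in> carrier W" and red: "reduced h s" for h
  proof (cases k)
    case 0
    then show ?thesis using h s len_B_le[of s] by (simp add: word_dist_def)
  next
    case (Suc n)
    have "(vor ^^ k) h \<preceq> (vor ^^ k) (h \<otimes> s)"
      using vor_pow_mono[of h "h \<otimes> s" k] red h s by (simp add: weak_le_mult_iff)
    moreover have "(vor ^^ k) (h \<otimes> s) \<preceq> (vor ^^ n) h"
      using vor_pow_mono[of "vor (h \<otimes> s)" h n] vor_edge(2)[OF h s red] h s
      by (simp add: Suc funpow_swap1)
    moreover have "len ((vor ^^ n) h) = len ((vor ^^ k) h) + len (proj (inv ((vor ^^ n) h)))"
      using len_vor[of "(vor ^^ n) h"] h by (simp add: Suc)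
    ultimately show ?thesis
      using weak_le_dist[of "(vor ^^ k) h" "(vor ^^ k) (h \<otimes> s)"]
        weak_le_len[of "(vor ^^ k) (h \<otimes> s)" "(vor ^^ n) h"]
        len_B_le[of "proj (inv ((vor ^^ n) h))"] h by simp
  qed
  show ?thesis
  proof (cases "reduced g s")
    case True
    then show ?thesis using up g by blast
  next
    case False
    have "reduced s (inv g) \<longleftrightarrow> reduced g s" using reduced_inv[of g s] g s by simp
    then have "s \<preceq> inv g" using False reduced_generator_iff[of s "inv g"] g s by simp
    then have "reduced s (s \<otimes> inv g)" using reduced_generator_cancel[of s "inv g"] g s by simp
    then have "reduced (g \<otimes> s) s"
      using reduced_inv[of s "s \<otimes> inv g"] g s by (simp add: inv_mult_group)
    from up[OF _ this] show ?thesis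
      using g s dist_commute[of "(vor ^^ k) g" "(vor ^^ k) (g \<otimes> s)"] by (simp add: m_assoc)
  qed
qed

lemma dist_vor_pow_le:
  assumes "g \<in> carrier W" "h \<in> carrier W"
  shows "wdist ((vor ^^ k) g) ((vor ^^ k) h) \<le> shadow_radius * wdist g h"
proof -
  have *: "wdist ((vor ^^ k) g) ((vor ^^ k) (g \<otimes> ev w)) \<le> shadow_radius * length w"
    if "w \<in> lists S" "g \<in> carrier W" for w g
    using that
  proof (induction w arbitrary: g)
    case (Cons a w)
    have a: "a \<in> S" "w \<in> lists S" "g \<in> carrier W" using Cons by simp_all
    have "wdist ((vor ^^ k) (g \<otimes> a)) ((vor ^^ k) (g \<otimes> a \<otimes> ev w)) \<le> shadow_radius * length w"
      using Cons.IH a by simp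
    then show ?case
      using dist_vor_pow_edge[of g a k] a
        dist_triangle[of "(vor ^^ k) g" "(vor ^^ k) (g \<otimes> a)" "(vor ^^ k) (g \<otimes> a \<otimes> ev w)"]
      by (simp add: m_assoc)
  qed simp
  obtain w where "w \<in> lists S" "ev w = inv g \<otimes> h" "length w = len (inv g \<otimes> h)"
    using obtain_reduced_word[of "inv g \<otimes> h"] assms by auto
  then show ?thesis using *[of w g] assms by (simp add: word_dist_def)
qed

text \<open>Let \<open>g\<close> lie on the identity side of the wall of the generator \<open>s\<close>. The wall is in reach
  of \<open>g\<close> if some step \<open>b \<in> B\<close> leads from \<open>g\<close> towards \<open>s\<close> but not towards the identity; such a
  step crosses the wall.\<close>

definition wall_in_reach :: "'a \<Rightarrow> 'a \<Rightarrow> bool" where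
  "wall_in_reach s g \<longleftrightarrow> (\<exists>b \<in> B. b \<preceq> inv g \<otimes> s \<and> \<not> b \<preceq> inv g)"

lemma reduced_inv_generator:
  "s \<in> S \<Longrightarrow> g \<in> carrier W \<Longrightarrow> reduced (inv g) s \<longleftrightarrow> \<not> s \<preceq> g"
  using reduced_inv[of s g] reduced_generator_iff[of s g] by simp

lemma not_weak_le_vor:
  assumes "s \<in> S" "g \<in> carrier W" "\<not> s \<preceq> g" shows "\<not> s \<preceq> vor g"
  using assms weak_le_trans[of s "vor g" g] vor_weak_le by auto

lemma vor_generator_mult:
  assumes s: "s \<in> S" and g: "g \<in> carrier W" and "\<not> s \<preceq> g" "\<not> wall_in_reach s g"
  shows "vor (s \<otimes> g) = s \<otimes> vor g"
proof -
  have "inv g \<preceq> inv g \<otimes> s"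
    using assms by (simp add: weak_le_mult_iff reduced_inv_generator)
  then have "proj (inv g) \<preceq> inv g \<otimes> s"
    using proj_weak_le[of "inv g"] weak_le_trans[of "proj (inv g)" "inv g" "inv g \<otimes> s"] g s by simp
  moreover have "b \<preceq> proj (inv g)" if "b \<in> B" "b \<preceq> inv g \<otimes> s" for b
    using that assms weak_le_proj[of "inv g" b] by (auto simp: wall_in_reach_def)
  ultimately have "proj (inv g \<otimes> s) = proj (inv g)"
    using g by (intro proj_eqI) simp_all
  then show ?thesis using g s by (simp add: voracious_proj_def inv_mult_group m_assoc)
qed

text \<open>Once the wall is in reach it stays in reach: the largest step \<open>q\<close> towards \<open>s\<close> extends the
  step \<open>p\<close> towards the identity, and the remainder \<open>c\<close> of \<open>q\<close> after \<open>p\<close> is a suffix, so it lies in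
  \<open>B\<close> and crosses the wall.\<close>

lemma wall_in_reach_vor:
  assumes s: "s \<in> S" and g: "g \<in> carrier W" and near: "\<not> s \<preceq> g" and "wall_in_reach s g"
  shows "wall_in_reach s (vor g)"
proof -
  define p where "p = proj (inv g)"
  define q where "q = proj (inv g \<otimes> s)"
  define y where "y = inv (vor g)"
  have p: "p \<in> B" and q: "q \<in> B" "q \<preceq> inv g \<otimes> s"
    using proj_weak_le[of "inv g \<otimes> s"] g s by (simp_all add: p_def q_def)
  have y: "y \<in> carrier W" "inv g = p \<otimes> y" "reduced p y"
    using inv_eq_proj_mult[OF g] g by (simp_all add: y_def p_def)
  obtain b where b: "b \<in> B" "b \<preceq> inv g \<otimes> s" "\<not> b \<preceq> inv g"
    using assms by (auto simp: wall_in_reach_def)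
  have "b \<preceq> q" unfolding q_def using b g s by (intro weak_le_proj) simp_all
  then have nq: "\<not> q \<preceq> inv g"
    using weak_le_trans[of b q "inv g"] b q g by auto
  have "inv g \<preceq> inv g \<otimes> s"
    using s g near by (simp add: weak_le_mult_iff reduced_inv_generator)
  then have "p \<preceq> inv g \<otimes> s"
    using proj_weak_le[of "inv g"] weak_le_trans[of p "inv g" "inv g \<otimes> s"] p g s
    by (simp add: p_def)
  then have "p \<preceq> q" unfolding q_def using p g s by (intro weak_le_proj) simp_all
  then obtain c where c: "c \<in> carrier W" "q = p \<otimes> c" "reduced p c"
    using weak_leE[of p q] p q by auto
  have "c \<in> B" using suffix_in_B[of p c] c p q by simp
  moreover have "c \<preceq> y \<otimes> s"
    using reduced_mult_cancel(1)[of p c "y \<otimes> s"] c p q y s by (simp add: m_assoc)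
  moreover have "\<not> c \<preceq> y"
    using reduced_mult_mono(2)[of p y c] c p y nq by auto
  ultimately show ?thesis using g by (auto simp: wall_in_reach_def y_def)
qed

text \<open>If the path \<open>w\<close> from \<open>g\<close> crosses the wall of \<open>s\<close>, then \<open>g\<close> is close to its mirror image
  \<open>s g\<close>: follow \<open>w\<close> across the wall and return along the mirror image.\<close>

lemma len_conjugate_le:
  assumes "s \<in> S" "w \<in> lists S" "g \<in> carrier W" "\<not> s \<preceq> g" "s \<preceq> g \<otimes> ev w"
  shows "len (inv g \<otimes> s \<otimes> g) \<le> 2 * length w"
  using assms(2-)
proof (induction w arbitrary: g)
  case (Cons a w)
  have a: "a \<in> S" "w \<in> lists S" "g \<in> carrier W" using Cons by simp_all
  show ?case
  proof (cases "s \<preceq> g \<otimes> a")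
    case True
    then have "s \<otimes> g = g \<otimes> a" using wall_crossing[of s a g] assms(1) a Cons.prems by simp
    then have "inv g \<otimes> s \<otimes> g = a" using a assms(1) by (simp add: m_assoc)
    then show ?thesis using len_generator[of a] a by simp
  next
    case False
    define c where "c = inv (g \<otimes> a) \<otimes> s \<otimes> (g \<otimes> a)"
    have "len c \<le> 2 * length w"
      unfolding c_def using Cons.IH[of "g \<otimes> a"] False a Cons.prems by (simp add: m_assoc)
    moreover have c: "c \<in> carrier W" using a assms(1) by (simp add: c_def)
    moreover have "inv g \<otimes> s \<otimes> g = a \<otimes> (c \<otimes> a)"
      using a assms(1) by (simp add: c_def inv_mult_group m_assoc)
    ultimately show ?thesis
      using len_mult_le[of a "c \<otimes> a"] len_mult_le[of c a] len_generator[of a] a by simp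
  qed
qed simp

lemma dist_wall_in_reach:
  assumes s: "s \<in> S" and g: "g \<in> carrier W" and near: "\<not> s \<preceq> g" and "wall_in_reach s g"
  shows "wdist g (s \<otimes> g) \<le> 2 * shadow_radius"
proof -
  obtain b where b: "b \<in> B" "b \<preceq> inv g \<otimes> s" "\<not> b \<preceq> inv g"
    using assms by (auto simp: wall_in_reach_def)
  have "s \<preceq> g \<otimes> b"
  proof (rule ccontr)
    assume not: "\<not> s \<preceq> g \<otimes> b"
    have "len (s \<otimes> (g \<otimes> b)) = len (g \<otimes> b) + 1"
      using len_generator_mult_if[of s "g \<otimes> b"] not s g b by simp
    moreover have "len (inv g \<otimes> s) = len (inv g) + 1"
      using reduced_inv_generator[OF s g] near len_generator[OF s] by (simp add: reduced_def)
    moreover have "len (inv b \<otimes> (inv g \<otimes> s)) = len (s \<otimes> (g \<otimes> b))"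
      using len_inv[of "s \<otimes> (g \<otimes> b)"] s g b by (simp add: inv_mult_group m_assoc del: len_inv)
    moreover have "len (inv b \<otimes> inv g) = len (g \<otimes> b)"
      using len_inv[of "g \<otimes> b"] g b by (simp add: inv_mult_group del: len_inv)
    ultimately show False using b(2,3) by (simp add: weak_le_def)
  qed
  moreover obtain w where "w \<in> lists S" "ev w = b" "length w = len b"
    using obtain_reduced_word[of b] b by auto
  ultimately have "len (inv g \<otimes> s \<otimes> g) \<le> 2 * len b"
    using len_conjugate_le[of s w g] s g near by simp
  then show ?thesis using len_B_le[OF b(1)] s g by (simp add: word_dist_def m_assoc)
qed

text \<open>The bound on the distance between the mirror image of the \<open>k\<close>-th projection of \<open>g\<close> and the
  \<open>k\<close>-th projection of \<open>s g\<close>. The first summand bounds the distance from a projection near the wall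
  to its mirror image, the second comes from the Lipschitz bound for points at distance at most
  twice the radius.\<close>

definition fellow_bound :: nat where
  "fellow_bound = 2 * shadow_radius + shadow_radius * (2 * shadow_radius)"

text \<open>By symmetry let \<open>g\<close> lie on the identity side of the wall of \<open>s\<close>. As long as the wall is out
  of reach, the sequences of projections of \<open>g\<close> and \<open>s g\<close> are mirror images of each other. From
  then on all projections of \<open>g\<close> stay close to the wall, hence close to their mirror images, and
  the two sequences stay close to each other because they were close when the wall came in reach.\<close>

lemma dist_vor_pow_generator_mult:
  assumes s: "s \<in> S" and g: "g \<in> carrier W"
  shows "wdist (s \<otimes> (vor ^^ k) g) ((vor ^^ k) (s \<otimes> g)) \<le> fellow_bound"
proof -
  have reach: "wall_in_reach s ((vor ^^ k) h) \<and> \<not> s \<preceq> (vor ^^ k) h"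
    if "h \<in> carrier W" "\<not> s \<preceq> h" "wall_in_reach s h" for h k
    using that by (induction k) (auto simp: s wall_in_reach_vor dest: not_weak_le_vor[OF s, rotated])
  have near: "wdist (s \<otimes> (vor ^^ k) h) ((vor ^^ k) (s \<otimes> h)) \<le> fellow_bound"
    if "h \<in> carrier W" "\<not> s \<preceq> h" for h k
    using that
  proof (induction k arbitrary: h)
    case 0
    then show ?case using s by simp
  next
    case (Suc k)
    show ?case
    proof (cases "wall_in_reach s h")
      case True
      let ?p = "(vor ^^ Suc k) h" and ?q = "(vor ^^ Suc k) (s \<otimes> h)"
      have "wdist ?p (s \<otimes> ?p) \<le> 2 * shadow_radius"
        by (rule dist_wall_in_reach) (use reach True Suc.prems s in \<open>simp_all del: funpow.simps\<close>)
      moreover have "wdist ?p ?q \<le> shadow_radius * (2 * shadow_radius)"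
      proof (rule order_trans)
        show "wdist ?p ?q \<le> shadow_radius * wdist h (s \<otimes> h)"
          using dist_vor_pow_le[of h "s \<otimes> h" "Suc k"] Suc.prems s by simp
        show "shadow_radius * wdist h (s \<otimes> h) \<le> shadow_radius * (2 * shadow_radius)"
          using dist_wall_in_reach[of s h] True Suc.prems s by (intro mult_le_mono2)
      qed
      ultimately show ?thesis
        using dist_triangle[of "s \<otimes> ?p" ?p ?q] dist_commute[of ?p "s \<otimes> ?p"] Suc.prems s
        by (simp add: fellow_bound_def del: funpow.simps)
    next
      case False
      then show ?thesis
        using Suc.IH[of "vor h"] vor_generator_mult[of s h] not_weak_le_vor[of s h] Suc.prems s
        by (simp add: funpow_swap1)
    qed
  qed
  show ?thesis
  proof (cases "s \<preceq> g")
    case False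
    then show ?thesis using near g by blast
  next
    case True
    define h where "h = s \<otimes> g"
    have h: "h \<in> carrier W" "g = s \<otimes> h" using s g by (simp_all add: h_def)
    have "\<not> s \<preceq> h"
      using reduced_generator_cancel[OF s g True] reduced_generator_iff[OF s h(1)]
      by (simp add: h_def)
    then have "wdist (s \<otimes> (vor ^^ k) h) ((vor ^^ k) g) \<le> fellow_bound" using near h by simp
    moreover have "wdist (s \<otimes> (vor ^^ k) h) ((vor ^^ k) g) = wdist ((vor ^^ k) h) (s \<otimes> (vor ^^ k) g)"
      using dist_mult_left[of s "s \<otimes> (vor ^^ k) h" "(vor ^^ k) g"] s h g by simp
    ultimately show ?thesis
      using dist_commute[of "(vor ^^ k) h" "s \<otimes> (vor ^^ k) g"] s g h(1) by (simp add: h_def)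
  qed
qed


section \<open>Voracious words and the fellow traveller property\<close>

abbreviation vword :: "'a \<Rightarrow> 'a list \<Rightarrow> bool" where "vword \<equiv> voracious_word W S B"

lemma is_arg_min_length_iff:
  assumes "h \<in> carrier W"
  shows "is_arg_min length (\<lambda>v. v \<in> lists S \<and> ev v = h) v \<longleftrightarrow>
    v \<in> lists S \<and> ev v = h \<and> length v = len h"
proof -
  obtain w where "w \<in> lists S" "ev w = h" "length w = len h"
    using obtain_reduced_word[OF assms] .
  then show ?thesis
    using len_ev_le by (fastforce simp: is_arg_min_linorder)
qed

lemma vword_iff:
  "vword g w \<longleftrightarrow> g = \<one> \<and> w = [] \<or>
    g \<in> carrier W \<and> g \<noteq> \<one> \<and>
    (\<exists>u v. w = u @ v \<and> vword (vor g) u \<and> v \<in> lists S \<and>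
      ev v = inv (vor g) \<otimes> g \<and> length v = len (inv (vor g) \<otimes> g))"
    (is "_ \<longleftrightarrow> ?one \<or> ?step")
proof
  assume "vword g w"
  then show "?one \<or> ?step"
  proof cases
    case (step u v)
    then have "v \<in> lists S \<and> ev v = inv (vor g) \<otimes> g \<and> length v = len (inv (vor g) \<otimes> g)"
      by (simp add: is_arg_min_length_iff)
    then show ?thesis using step by blast
  qed simp
next
  assume "?one \<or> ?step"
  then show "vword g w"
  proof
    assume ?step
    then obtain u v where *: "g \<in> carrier W" "g \<noteq> \<one>" "w = u @ v" "vword (vor g) u"
      "v \<in> lists S \<and> ev v = inv (vor g) \<otimes> g \<and> length v = len (inv (vor g) \<otimes> g)"
      by blast
    show ?thesis
      unfolding *(3) using * by (intro voracious_word.step) (simp_all add: is_arg_min_length_iff)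
  qed (simp add: voracious_word.one)
qed

lemma vword_reduced:
  assumes "vword g w"
  shows "g \<in> carrier W \<and> w \<in> lists S \<and> ev w = g \<and> length w = len g"
  using assms
proof (induction rule: voracious_word.induct)
  case (step g u v)
  then have v: "v \<in> lists S" "ev v = inv (vor g) \<otimes> g" "length v = len (inv (vor g) \<otimes> g)"
    by (simp_all add: is_arg_min_length_iff)
  then show ?case using step vor_weak_le[of g] by (simp add: weak_le_def)
qed simp

lemma vword_exists: "g \<in> carrier W \<Longrightarrow> \<exists>w. vword g w"
proof (induction "len g" arbitrary: g rule: less_induct)
  case less
  show ?case
  proof (cases "g = \<one>")
    case False
    then obtain u where "vword (vor g) u"
      using less.hyps[of "vor g"] less.prems len_vor_less[of g] by auto
    moreover obtain v where "v \<in> lists S" "ev v = inv (vor g) \<otimes> g" "length v = len (inv (vor g) \<otimes> g)"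
      using obtain_reduced_word[of "inv (vor g) \<otimes> g"] less.prems by auto
    ultimately have "vword g (u @ v)" using False less.prems vword_iff[of g "u @ v"] by blast
    then show ?thesis by blast
  qed (auto intro: voracious_word.one)
qed

lemma vword_take_vor:
  assumes "vword g w" shows "vword (vor g) (take (len (vor g)) w)"
  using assms
proof cases
  case (step u v)
  then show ?thesis using vword_reduced[of "vor g" u] by simp
qed (simp add: voracious_word.one)

lemma vword_take_vor_pow:
  assumes "vword g w" shows "vword ((vor ^^ k) g) (take (len ((vor ^^ k) g)) w)"
proof (induction k)
  case 0
  then show ?case using assms vword_reduced[OF assms] by simp
next
  case (Suc k)
  have "len (vor ((vor ^^ k) g)) \<le> len ((vor ^^ k) g)"
    using vword_reduced[OF assms] vor_weak_le[of "(vor ^^ k) g"] weak_le_len by simp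
  then show ?case using vword_take_vor[OF Suc] by (simp add: min_def)
qed

lemma vor_pow_near_prefix:
  assumes "vword g w"
  shows "\<exists>k. wdist ((vor ^^ k) g) (ev (take i w)) \<le> shadow_radius"
  using assms
proof (induction arbitrary: i rule: voracious_word.induct)
  case one
  then show ?case by (intro exI[of _ 0]) simp
next
  case (step g u v)
  then have v: "v \<in> lists S" "ev v = inv (vor g) \<otimes> g" "length v = len (inv (vor g) \<otimes> g)"
    by (simp_all add: is_arg_min_length_iff)
  have u: "u \<in> lists S" "ev u = vor g" "length u = len (vor g)"
    using vword_reduced[OF step(3)] by simp_all
  show ?case
  proof (cases "i \<le> length u")
    case True
    obtain k where "wdist ((vor ^^ k) (vor g)) (ev (take i u)) \<le> shadow_radius"
      using step.IH by blast
    then show ?thesis using True by (intro exI[of _ "Suc k"]) (simp add: funpow_swap1)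
  next
    case False
    define t where "t = take (i - length u) v"
    have t: "t \<in> lists S" using v by (auto simp: t_def in_lists_conv_set dest: in_set_takeD)
    have "take i (u @ v) = u @ t" using False by (simp add: t_def)
    then have "wdist (vor g) (ev (take i (u @ v))) = len (ev t)"
      using u t step(1) by (simp add: word_dist_def)
    also have "\<dots> \<le> length t" using len_ev_le[OF t] .
    also have "\<dots> \<le> length v" by (simp add: t_def)
    also have "\<dots> \<le> shadow_radius"
    proof -
      have "inv (vor g) \<otimes> g = inv (proj (inv g))"
        using step(1) by (simp add: voracious_proj_def inv_mult_group m_assoc)
      then show ?thesis using v(3) len_B_le[of "proj (inv g)"] step(1) by simp
    qed
    finally show ?thesis by (intro exI[of _ 1]) simp
  qed
qed

lemma take_in_lists: "w \<in> lists S \<Longrightarrow> take i w \<in> lists S"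
  by (auto simp: in_lists_conv_set dest: in_set_takeD)

lemma wdist_prefixes_le:
  assumes "w \<in> lists S" "i \<le> j"
  shows "wdist (ev (take i w)) (ev (take j w)) \<le> j - i"
proof -
  have d: "drop i w \<in> lists S" using assms by (auto simp: in_lists_conv_set dest: in_set_dropD)
  have "take j w = take i w @ take (j - i) (drop i w)"
    using take_add[of i "j - i" w] assms by simp
  then have "ev (take j w) = ev (take i w) \<otimes> ev (take (j - i) (drop i w))"
    using take_in_lists assms d by simp
  then show ?thesis
    using len_ev_le[of "take (j - i) (drop i w)"] take_in_lists[OF assms(1)] take_in_lists[OF d]
    by (simp add: word_dist_def)
qed

lemma len_prefix:
  assumes "vword g w" shows "len (ev (take i w)) = min i (len g)"
proof -
  have w: "w \<in> lists S" "ev w = g" "length w = len g" using vword_reduced[OF assms] by simp_all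
  have d: "drop i w \<in> lists S" using w by (auto simp: in_lists_conv_set dest: in_set_dropD)
  have "ev (take i w @ drop i w) = ev (take i w) \<otimes> ev (drop i w)"
    by (rule ev_append) (use take_in_lists[OF w(1)] d in simp_all)
  then have "len g \<le> len (ev (take i w)) + len (ev (drop i w))"
    using len_mult_le[of "ev (take i w)" "ev (drop i w)"] take_in_lists[OF w(1), of i] d w(2) by simp
  then show ?thesis
    using len_ev_le[of "take i w"] len_ev_le[of "drop i w"] take_in_lists[OF w(1), of i] d w(3)
    by (simp add: min_def split: if_splits)
qed

text \<open>Both words are geodesics through the iterated projections, so a bound for the projections of
  equal index also bounds the difference of their lengths, which synchronises the prefixes. The
  cases needed are \<open>z = \<one>\<close> and \<open>z \<in> S\<close>.\<close>

lemma fellow_travel: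
  assumes v: "vword g v" and v': "vword g' v'" and z: "z \<in> carrier W" "len z \<le> 1"
    and K: "\<And>k. wdist (z \<otimes> (vor ^^ k) g) ((vor ^^ k) g') \<le> K"
  shows "wdist (z \<otimes> ev (take i v)) (ev (take i v')) \<le> 2 * shadow_radius + 3 * K + 2"
proof -
  have g: "g \<in> carrier W" "v \<in> lists S" and g': "g' \<in> carrier W" "v' \<in> lists S" "length v' = len g'"
    using vword_reduced[OF v] vword_reduced[OF v'] by simp_all
  define x where "x = ev (take i v)"
  have x: "x \<in> carrier W" using take_in_lists[OF g(2)] by (simp add: x_def)
  have len_x: "len x = min i (len g)" using len_prefix[OF v] by (simp add: x_def)
  obtain k where k: "wdist ((vor ^^ k) g) x \<le> shadow_radius"
    using vor_pow_near_prefix[OF v] unfolding x_def by blast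
  define y where "y = (vor ^^ k) g"
  define y' where "y' = (vor ^^ k) g'"
  have y: "y \<in> carrier W" "y' \<in> carrier W" using g g' by (simp_all add: y_def y'_def)
  have yx: "wdist y x \<le> shadow_radius" using k by (simp add: y_def)
  have zy: "wdist (z \<otimes> y) y' \<le> K" using K[of k] by (simp add: y_def y'_def)
  have len_z: "len (z \<otimes> h) \<le> len h + 1" "len h \<le> len (z \<otimes> h) + 1" if "h \<in> carrier W" for h
    using len_mult_le[of z h] len_mult_le[of "inv z" "z \<otimes> h"] z that by simp_all
  have len_gg': "len g \<le> len g' + (K + 1)" "len g' \<le> len g + (K + 1)"
    using K[of 0] len_z[OF g(1)] len_le_dist[of "z \<otimes> g" g'] len_le_dist[of g' "z \<otimes> g"]
      dist_commute[of g' "z \<otimes> g"] z g g' by simp_all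
  have len_yy': "len y \<le> len y' + (K + 1)" "len y' \<le> len y + (K + 1)"
    using zy len_z[OF y(1)] len_le_dist[of "z \<otimes> y" y'] len_le_dist[of y' "z \<otimes> y"]
      dist_commute[of y' "z \<otimes> y"] z y by simp_all
  have len_xy: "len x \<le> len y + shadow_radius" "len y \<le> len x + shadow_radius"
    using yx len_le_dist[of x y] len_le_dist[of y x] dist_commute[of x y] x y by simp_all
  define m where "m = min i (len g')"
  have x': "ev (take i v') = ev (take m v')" by (simp add: m_def g'(3)[symmetric] min_def)
  have y': "y' = ev (take (len y') v')"
    using vword_reduced[OF vword_take_vor_pow[OF v', of k]] by (simp add: y'_def)
  have "m \<le> len y' + (shadow_radius + 2 * K + 2)" "len y' \<le> m + (shadow_radius + 2 * K + 2)"
    using len_gg' len_yy' len_xy len_x unfolding m_def by linarith+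
  then have "wdist y' (ev (take m v')) \<le> shadow_radius + 2 * K + 2"
    using wdist_prefixes_le[OF g'(2), of "len y'" m] wdist_prefixes_le[OF g'(2), of m "len y'"]
      dist_commute[of y' "ev (take m v')"] y'[symmetric] y take_in_lists[OF g'(2)]
    by (cases "m \<le> len y'") simp_all
  moreover have "wdist (z \<otimes> x) (z \<otimes> y) \<le> shadow_radius"
    using dist_mult_left[of z x y] dist_commute[of x y] yx x y z by simp
  ultimately show ?thesis
    using dist_triangle[of "z \<otimes> x" "z \<otimes> y" "ev (take m v')"] dist_triangle[of "z \<otimes> y" y' "ev (take m v')"]
      zy x y z take_in_lists[OF g'(2)] unfolding x' x_def[symmetric] by simp
qed


section \<open>Regularity\<close>

text \<open>Whether \<open>s\<close> is a left descent of \<open>y\<close>, and the projection of \<open>s y\<close> if it is not, depend only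
  on the projection of \<open>y\<close>.\<close>

lemma proj_generator_mult:
  assumes s: "s \<in> S" and y: "y \<in> carrier W" and "\<not> s \<preceq> y"
  shows "proj (s \<otimes> y) = proj (s \<otimes> proj y)"
proof -
  define q where "q = proj (s \<otimes> y)"
  define e where "e = proj y"
  have red: "reduced s y" using reduced_generator_iff assms by blast
  have e: "e \<in> B" "e \<preceq> y" using y proj_weak_le by (simp_all add: e_def)
  have se: "reduced s e" "s \<otimes> e \<preceq> s \<otimes> y" using reduced_mult_mono[OF red e(2)] e s y by simp_all
  have q: "q \<in> B" "q \<preceq> s \<otimes> y" using s y proj_weak_le[of "s \<otimes> y"] by (simp_all add: q_def)
  have "s \<preceq> q"
    unfolding q_def by (rule weak_le_proj) (use s y red in \<open>simp_all add: weak_le_mult_iff\<close>)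
  then obtain d where d: "d \<in> carrier W" "q = s \<otimes> d" "reduced s d"
    using weak_leE[of s q] s q by auto
  have "d \<in> B" using suffix_in_B[of s d] d q s by simp
  moreover have "d \<preceq> y" using reduced_mult_cancel(1)[of s d y] d q s y by simp
  ultimately have "d \<preceq> e" using weak_le_proj y by (simp add: e_def)
  then have "q \<preceq> s \<otimes> e" using reduced_mult_mono(2)[OF se(1)] d s e by simp
  moreover have "b \<preceq> q" if "b \<in> B" "b \<preceq> s \<otimes> e" for b
    unfolding q_def using that weak_le_trans[of b "s \<otimes> e" "s \<otimes> y"] se s y e
    by (intro weak_le_proj) simp_all
  ultimately have "proj (s \<otimes> e) = q" using q(1) by (intro proj_eqI)
  then show ?thesis by (simp add: q_def e_def)
qed

text \<open>The same for the left multiplication by an arbitrary element, one letter at a time.\<close>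

lemma reduced_proj_transfer:
  assumes c: "c \<in> carrier W" and x: "x \<in> carrier W" and red: "reduced c (proj x)"
  shows "reduced c x" "proj (c \<otimes> x) = proj (c \<otimes> proj x)"
proof -
  define p where "p = proj x"
  have p: "p \<in> carrier W" using x by (simp add: p_def)
  have *: "len (ev w \<otimes> x) = length w + len x \<and> proj (ev w \<otimes> x) = proj (ev w \<otimes> p)"
    if "w \<in> lists S" "len (ev w \<otimes> p) = length w + len p" for w
    using that
  proof (induction w)
    case Nil
    have "proj p = p" by (rule proj_eqI) (use x p in \<open>simp_all add: p_def\<close>)
    then show ?case using x p by (simp add: p_def)
  next
    case (Cons s w)
    have mem: "s \<in> S" "w \<in> lists S" using Cons.hyps by simp_all
    define y where "y = ev w \<otimes> x"
    define y' where "y' = ev w \<otimes> p"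
    have y: "y \<in> carrier W" "y' \<in> carrier W" using mem x p by (simp_all add: y_def y'_def)
    have sy: "ev (s # w) \<otimes> x = s \<otimes> y" "ev (s # w) \<otimes> p = s \<otimes> y'"
      using mem x p by (simp_all add: y_def y'_def m_assoc)
    have len': "len (s \<otimes> y') = Suc (length w + len p)" using Cons.prems sy by simp
    have "len y' = length w + len p"
      using len' len_generator_mult[OF mem(1) y(2)] len_mult_le[of "ev w" p] len_ev_le[OF mem(2)] mem p
      by (auto simp: y'_def)
    then have IH: "len y = length w + len x" "proj y = proj y'" and not: "\<not> s \<preceq> y'"
      using Cons.IH len' generator_weak_le_iff[OF mem(1) y(2)] by (simp_all add: y_def y'_def)
    have "s \<preceq> proj y \<Longrightarrow> s \<preceq> y'"
      using weak_le_trans[of s "proj y'" y'] proj_weak_le[of y'] IH mem y by simp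
    then have not': "\<not> s \<preceq> y" using not weak_le_proj[of y s] mem y by auto
    then have "len (s \<otimes> y) = Suc (len y)" using len_generator_mult_if mem y by simp
    moreover have "proj (s \<otimes> y) = proj (s \<otimes> y')"
      using proj_generator_mult[OF mem(1) y(1) not'] proj_generator_mult[OF mem(1) y(2) not] IH by simp
    ultimately show ?case using IH sy by simp
  qed
  obtain w where "w \<in> lists S" "ev w = c" "length w = len c"
    using obtain_reduced_word[OF c] .
  then show "reduced c x" "proj (c \<otimes> x) = proj (c \<otimes> proj x)"
    using *[of w] red by (simp_all add: reduced_def p_def)
qed

text \<open>The left-hand side says that the voracious projection takes \<open>h c\<^sup>-\<^sup>1\<close> to \<open>h\<close> by the step \<open>c\<close>,
  with lengths adding up. The right-hand side tests this with the finitely many values of \<open>c\<close> and of the projection of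
  \<open>h\<^sup>-\<^sup>1\<close> only.\<close>

lemma vor_block_iff:
  assumes h: "h \<in> carrier W" and c: "c \<in> B"
  shows "proj (c \<otimes> inv h) = c \<and> reduced c (inv h) \<longleftrightarrow>
    proj (c \<otimes> proj (inv h)) = c \<and> reduced c (proj (inv h))"
proof
  assume *: "proj (c \<otimes> inv h) = c \<and> reduced c (inv h)"
  have le: "reduced c (proj (inv h))" "c \<otimes> proj (inv h) \<preceq> c \<otimes> inv h"
    using reduced_mult_mono[of c "inv h" "proj (inv h)"] proj_weak_le[of "inv h"] * h c by simp_all
  have "proj (c \<otimes> proj (inv h)) = c"
  proof (rule proj_eqI)
    show "c \<preceq> c \<otimes> proj (inv h)" using le c h by (simp add: weak_le_mult_iff)
    fix b assume b: "b \<in> B" "b \<preceq> c \<otimes> proj (inv h)"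
    then have "b \<preceq> c \<otimes> inv h"
      using weak_le_trans[of b "c \<otimes> proj (inv h)" "c \<otimes> inv h"] le c h by simp
    then have "b \<preceq> proj (c \<otimes> inv h)" using b c h by (intro weak_le_proj) simp_all
    then show "b \<preceq> c" using * by simp
  qed (use c in simp)
  then show "proj (c \<otimes> proj (inv h)) = c \<and> reduced c (proj (inv h))" using le by blast
next
  assume "proj (c \<otimes> proj (inv h)) = c \<and> reduced c (proj (inv h))"
  then show "proj (c \<otimes> inv h) = c \<and> reduced c (inv h)"
    using reduced_proj_transfer[of c "inv h"] h c by simp
qed

text \<open>Appending one block to a voracious word for \<open>h\<close>, with the condition on the block expressed
  in terms of the projection of \<open>h\<^sup>-\<^sup>1\<close>.\<close>

lemma vword_block_iff:
  "vword g w \<longleftrightarrow> g = \<one> \<and> w = [] \<or>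
    (\<exists>h u v. w = u @ v \<and> v \<noteq> [] \<and> vword h u \<and> v \<in> lists S \<and> g = h \<otimes> ev v \<and>
      inv (ev v) \<in> B \<and> length v = len (ev v) \<and>
      proj (inv (ev v) \<otimes> proj (inv h)) = inv (ev v) \<and> reduced (inv (ev v)) (proj (inv h)))"
    (is "_ \<longleftrightarrow> _ \<or> ?R")
proof -
  have "?R" if g: "g \<in> carrier W" "g \<noteq> \<one>" and w: "w = u @ v" "vword (vor g) u" "v \<in> lists S"
    "ev v = inv (vor g) \<otimes> g" "length v = len (inv (vor g) \<otimes> g)" for u v
  proof -
    have p: "inv (ev v) = proj (inv g)"
      using g w(4) inv_eq_proj_mult(1)[OF g(1)] by (simp add: voracious_proj_def inv_mult_group m_assoc)
    have "inv (ev v) \<otimes> inv (vor g) = inv g" using inv_eq_proj_mult(1)[OF g(1)] p by simp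
    then have "proj (inv (ev v) \<otimes> inv (vor g)) = inv (ev v) \<and> reduced (inv (ev v)) (inv (vor g))"
      using inv_eq_proj_mult(2)[OF g(1)] p by simp
    moreover have "v \<noteq> []"
      using p proj_eq_one_iff[of "inv g"] g by auto
    moreover have "inv (ev v) \<in> B" using p g by simp
    ultimately show ?R using vor_block_iff[of "vor g" "inv (ev v)"] g w
      by (intro exI[of _ "vor g"] exI[of _ u] exI[of _ v]) simp
  qed
  moreover have "vword g w" if "?R"
  proof -
    from that obtain h u v where *: "w = u @ v" "v \<noteq> []" "vword h u" "v \<in> lists S" "g = h \<otimes> ev v"
      "inv (ev v) \<in> B" "length v = len (ev v)"
      "proj (inv (ev v) \<otimes> proj (inv h)) = inv (ev v) \<and> reduced (inv (ev v)) (proj (inv h))"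
      by blast
    have h: "h \<in> carrier W" using vword_reduced *(3) by blast
    have g: "g \<in> carrier W" "inv g = inv (ev v) \<otimes> inv h" using * h by (simp_all add: inv_mult_group)
    have p: "proj (inv g) = inv (ev v)" using vor_block_iff[of h "inv (ev v)"] h * g by simp
    then have vor: "vor g = h" using * h by (simp add: voracious_proj_def m_assoc)
    have "ev v \<noteq> \<one>" using *(2,7) by auto
    then have "inv g \<noteq> \<one>" using p proj_eq_one_iff[of "inv g"] g(1) *(4) by simp
    then have "g \<noteq> \<one>" by auto
    moreover have "ev v = inv (vor g) \<otimes> g" using vor * h by simp
    ultimately show ?thesis using vword_iff[of g w] g * vor by metis
  qed
  ultimately show ?thesis using vword_iff[of g w] voracious_word.one[of W S B] by blast
qed

text \<open>The state reached by a word \<open>w\<close> records, for each voracious prefix of \<open>w\<close> that leaves a rest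
  no longer than a block can be, the projection that governs the block after this prefix, and the
  rest.\<close>

definition block_state :: "'a list \<Rightarrow> ('a \<times> 'a list) set" where
  "block_state w = {(p, r). \<exists>u h. w = u @ r \<and> vword h u \<and> p = proj (inv h) \<and> length r \<le> shadow_radius}"

text \<open>A further letter either prolongs the rest or completes it to a block; then the whole word is
  voracious, and the inverse of the block is the new projection.\<close>

definition block_step :: "('a \<times> 'a list) set \<Rightarrow> 'a \<Rightarrow> ('a \<times> 'a list) set" where
  "block_step Q a =
     {(p, r @ [a]) | p r. (p, r) \<in> Q \<and> length r < shadow_radius} \<union>
     {(inv (ev v), []) | p r v. (p, r) \<in> Q \<and> v = r @ [a] \<and> inv (ev v) \<in> B \<and>
        length v = len (ev v) \<and> proj (inv (ev v) \<otimes> p) = inv (ev v) \<and> reduced (inv (ev v)) p}"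

lemma block_state_snoc:
  assumes "w \<in> lists S" "a \<in> S"
  shows "block_state (w @ [a]) = block_step (block_state w) a"
proof (rule Set.set_eqI, clarify)
  fix p x
  show "(p, x) \<in> block_state (w @ [a]) \<longleftrightarrow> (p, x) \<in> block_step (block_state w) a"
  proof (cases x rule: rev_cases)
    case (snoc r b)
    then show ?thesis by (auto simp: block_state_def block_step_def)
  next
    case Nil
    have proj: "proj (inv (h \<otimes> ev v)) = inv (ev v)"
      if "h \<in> carrier W" "v \<in> lists S" "inv (ev v) \<in> B"
        "proj (inv (ev v) \<otimes> proj (inv h)) = inv (ev v)" "reduced (inv (ev v)) (proj (inv h))" for h v
      using vor_block_iff[of h "inv (ev v)"] that by (simp add: inv_mult_group)
    have "(p, []) \<in> block_state (w @ [a]) \<longleftrightarrow> (\<exists>g. vword g (w @ [a]) \<and> p = proj (inv g))"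
      by (auto simp: block_state_def)
    also have "\<dots> \<longleftrightarrow> (p, []) \<in> block_step (block_state w) a"
    proof
      assume "\<exists>g. vword g (w @ [a]) \<and> p = proj (inv g)"
      then obtain g where g: "vword g (w @ [a])" "p = proj (inv g)" by blast
      then obtain h u v where *: "w @ [a] = u @ v" "v \<noteq> []" "vword h u" "v \<in> lists S" "g = h \<otimes> ev v"
        "inv (ev v) \<in> B" "length v = len (ev v)"
        "proj (inv (ev v) \<otimes> proj (inv h)) = inv (ev v)" "reduced (inv (ev v)) (proj (inv h))"
        using vword_block_iff[of g "w @ [a]"] by blast
      then obtain r where r: "v = r @ [a]" "w = u @ r" by (cases v rule: rev_cases) auto
      have "length v \<le> shadow_radius" using *(4,6,7) len_B_le[of "inv (ev v)"] by simp
      then have "(proj (inv h), r) \<in> block_state w" using r * by (auto simp: block_state_def)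
      moreover have "p = inv (ev v)" using proj[of h v] * g vword_reduced[of h u] by simp
      ultimately show "(p, []) \<in> block_step (block_state w) a"
        using * r unfolding block_step_def by blast
    next
      assume "(p, []) \<in> block_step (block_state w) a"
      then obtain q r v where *: "(q, r) \<in> block_state w" "v = r @ [a]" "inv (ev v) \<in> B"
        "length v = len (ev v)" "proj (inv (ev v) \<otimes> q) = inv (ev v)" "reduced (inv (ev v)) q"
        "p = inv (ev v)"
        by (auto simp: block_step_def)
      then obtain u h where uh: "w = u @ r" "vword h u" "q = proj (inv h)"
        by (auto simp: block_state_def)
      have v: "v \<in> lists S" using assms * uh by simp
      have "vword (h \<otimes> ev v) (w @ [a])"
        by (subst vword_block_iff, intro disjI2 exI[of _ h] exI[of _ u] exI[of _ v])
          (use * uh v in simp)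
      moreover have "p = proj (inv (h \<otimes> ev v))" using proj[of h v] * uh v vword_reduced[of h u] by simp
      ultimately show "\<exists>g. vword g (w @ [a]) \<and> p = proj (inv g)" by blast
    qed
    finally show ?thesis using Nil by simp
  qed
qed

lemma block_state_accepts: "w \<in> voracious_language W S B \<longleftrightarrow> (\<exists>p. (p, []) \<in> block_state w)"
  using vword_reduced by (auto simp: voracious_language_def block_state_def)

lemma finite_block_states:
  assumes "finite S" shows "finite (block_state ` lists S)"
proof -
  have "block_state w \<subseteq> B \<times> {r. set r \<subseteq> S \<and> length r \<le> shadow_radius}" if "w \<in> lists S" for w
  proof clarify
    fix p r assume "(p, r) \<in> block_state w"
    then obtain u h where "w = u @ r" "vword h u" "p = proj (inv h)" "length r \<le> shadow_radius"
      by (auto simp: block_state_def)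
    then show "p \<in> B \<and> r \<in> {r. set r \<subseteq> S \<and> length r \<le> shadow_radius}"
      using that vword_reduced[of h u] by auto
  qed
  then have "block_state ` lists S \<subseteq> Pow (B \<times> {r. set r \<subseteq> S \<and> length r \<le> shadow_radius})"
    by blast
  moreover have "finite (B \<times> {r. set r \<subseteq> S \<and> length r \<le> shadow_radius})"
    using finite_lists_length_le[OF assms] finite_B by simp
  ultimately show ?thesis by (meson finite_Pow_iff finite_subset)
qed

end

text \<open>A language is regular if membership of a word is determined by a value, from a finite set,
  that can be updated letter by letter.\<close>

lemma regular_language_if_finite_state:
  fixes f :: "'a list \<Rightarrow> 'c"
  assumes fin: "finite (f ` lists S)" and L: "L \<subseteq> lists S"
    and step: "\<And>w a. w \<in> lists S \<Longrightarrow> a \<in> S \<Longrightarrow> f (w @ [a]) = t (f w) a"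
    and acc: "\<And>w. w \<in> L \<longleftrightarrow> P (f w)"
  shows "regular_language S L"
proof -
  obtain e :: "'c \<Rightarrow> nat" where e: "inj_on e (f ` lists S)"
    using finite_imp_inj_to_nat_seg[OF fin] by metis
  define d where "d = inv_into (f ` lists S) e"
  have d: "d (e (f w)) = f w" if "w \<in> lists S" for w
    using e that by (simp add: d_def)
  define \<delta> where "\<delta> q a = e (t (d q) a)" for q a
  have \<delta>: "\<delta> (e (f w)) a = e (f (w @ [a]))" if "w \<in> lists S" "a \<in> S" for w a
    using that by (simp add: \<delta>_def d step)
  have run: "foldl \<delta> (e (f [])) w = e (f w)" if "w \<in> lists S" for w
    using that by (induction w rule: rev_induct) (simp_all add: \<delta>)
  let ?Q = "e ` f ` lists S"
  have "finite ?Q" using fin by simp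
  moreover have "e (f []) \<in> ?Q" by auto
  moreover have "e ` f ` L \<subseteq> ?Q" using L by auto
  moreover have "\<forall>q \<in> ?Q. \<forall>a \<in> S. \<delta> q a \<in> ?Q"
  proof (intro ballI)
    fix q a assume "q \<in> ?Q" "a \<in> S"
    then obtain w where w: "w \<in> lists S" "q = e (f w)" by blast
    then have "w @ [a] \<in> lists S" using \<open>a \<in> S\<close> by simp
    then show "\<delta> q a \<in> ?Q" using \<delta>[OF w(1) \<open>a \<in> S\<close>] w(2) by auto
  qed
  moreover have "L = {w \<in> lists S. foldl \<delta> (e (f [])) w \<in> e ` f ` L}"
  proof (intro equalityI subsetI CollectI conjI)
    fix w assume "w \<in> L"
    then show "w \<in> lists S" using L by blast
    then show "foldl \<delta> (e (f [])) w \<in> e ` f ` L" using \<open>w \<in> L\<close> by (simp add: run)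
  next
    fix w assume "w \<in> {w \<in> lists S. foldl \<delta> (e (f [])) w \<in> e ` f ` L}"
    then have w: "w \<in> lists S" "foldl \<delta> (e (f [])) w \<in> e ` f ` L" by blast+
    then obtain v where v: "v \<in> L" "e (f w) = e (f v)" unfolding run[OF w(1)] by blast
    have "f w = f v" by (rule inj_onD[OF e v(2)]) (use w v L in blast)+
    then show "w \<in> L" using acc v by simp
  qed
  ultimately show ?thesis unfolding regular_language_def by blast
qed


section \<open>The biautomatic structure\<close>

theorem theorem1p1:
  fixes W :: "('a, 'b) monoid_scheme" and S B :: "'a set"
  assumes "coxeter_system W S" and "finite S"
    and "garside_shadow W S B" and "finite B"
  shows "biautomatic_structure W S (voracious_language W S B)"
proof -
  interpret finite_garside_shadow W S B
    using assms by unfold_locales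
  let ?L = "voracious_language W S B"
  have vword: "vword (ev v) v" "v \<in> lists S" if "v \<in> ?L" for v
    using that vword_reduced by (auto simp: voracious_language_def)
  have gen: "generate W S = carrier W" using assms(1) by (simp add: coxeter_system_def)
  have reg: "regular_language S ?L"
  proof (rule regular_language_if_finite_state[OF finite_block_states[OF assms(2)],
        where t = block_step and P = "\<lambda>Q. \<exists>p. (p, []) \<in> Q"])
    show "?L \<subseteq> lists S" using vword(2) by blast
  qed (simp_all add: block_state_snoc block_state_accepts)
  have ex: "\<exists>v \<in> ?L. ev v = g" if g: "g \<in> carrier W" for g
  proof -
    obtain v where "vword g v" using vword_exists[OF g] by blast
    then show ?thesis using g vword_reduced[of g v] by (auto simp: voracious_language_def)
  qed
  have right: "wdist (ev (take i v)) (ev (take i v')) \<le> 2 * shadow_radius + 3 * shadow_radius + 2"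
    if "v \<in> ?L" "v' \<in> ?L" "s \<in> S" "ev v' = ev v \<otimes>\<^bsub>W\<^esub> s" for v v' s i
    using fellow_travel[of "ev v" v "ev v'" v' "\<one>\<^bsub>W\<^esub>" shadow_radius i] vword[OF that(1)] vword[OF that(2)]
      dist_vor_pow_edge[of "ev v" s] that take_in_lists by simp
  have left: "wdist (s \<otimes>\<^bsub>W\<^esub> ev (take i v)) (ev (take i v')) \<le> 2 * shadow_radius + 3 * fellow_bound + 2"
    if "v \<in> ?L" "v' \<in> ?L" "s \<in> S" "ev v' = s \<otimes>\<^bsub>W\<^esub> ev v" for v v' s i
    using fellow_travel[of "ev v" v "ev v'" v' s fellow_bound i] vword[OF that(1)] vword[OF that(2)]
      dist_vor_pow_generator_mult[of s "ev v"] that len_generator_le by simp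
  show ?thesis
    unfolding biautomatic_structure_def
  proof (intro conjI)
    show "S \<subseteq> carrier W" "\<forall>s \<in> S. inv\<^bsub>W\<^esub> s \<in> S" by auto
    show "?L \<subseteq> lists S" using vword(2) by blast
    show "\<forall>g \<in> carrier W. \<exists>v \<in> ?L. ev v = g" using ex by blast
    show "\<exists>C. \<forall>v \<in> ?L. \<forall>v' \<in> ?L. \<forall>s \<in> S. ev v' = ev v \<otimes>\<^bsub>W\<^esub> s \<longrightarrow>
        (\<forall>i \<ge> 1. wdist (ev (take i v)) (ev (take i v')) \<le> C)"
      using right by blast
    show "\<exists>C. \<forall>v \<in> ?L. \<forall>v' \<in> ?L. \<forall>s \<in> S. ev v' = s \<otimes>\<^bsub>W\<^esub> ev v \<longrightarrow>
        (\<forall>i \<ge> 1. wdist (s \<otimes>\<^bsub>W\<^esub> ev (take i v)) (ev (take i v')) \<le> C)"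
      using left by blast
  qed (use assms(2) gen reg in simp_all)
qed

end
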